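(* (Metrizable version.) For a metrizable space $X$ the following conditions are equivalent: (a) $X$ is a coset space of a metrizable topological group $G$; (b) there is a metric $\rho$ on $X$ (compatible with the topology of $X$) such that $X$ is a coset space of the group of all uniform equivalences of $(X,\rho)$ endowed with the topology of uniform convergence with respect to $\rho$. (Separable version.) For a separable metrizable space $X$ the following conditions are equivalent: (a) $X$ is a coset space of a separable metrizable topological group $G$; (b) there is a totally bounded metric $\rho$ on $X$ (compatible with the topology of $X$) such that $X$ is a coset space of the group of all uniform equivalences of $(X,\rho)$ endowed with the topology of uniform convergence with respect to $\rho$.
   Context: All spaces (including topological groups) are Tychonoff. A space $X$ is a coset space of a topological group $G$ if $X$ is homeomorphic to $G/H$ (with the quotient topology) for some closed subgroup $H\subset G$. A uniform equivalence of $(X,\rho)$ is a bijection $f:X\to X$ such that $f$ and $f^{-1}$ are uniformly continuous with respect to $\rho$. The topology of uniform convergence on the group of uniform equivalences is the group topology for which the sets $\{g : \rho(g(x),x)<\varepsilon \text{ for all } x\in X\}$, $\varepsilon>0$, form a base of (not necessarily open) neighborhoods of the identity. *)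

theory Defs
  imports "HOL-Analysis.Analysis" "HOL-Algebra.Bij" "HOL-Algebra.Left_Coset"
begin

section \<open>Topological groups and coset spaces\<close>

text \<open>All spaces, topological groups included, are Tychonoff.\<close>

definition topological_group :: "('g, 'm) monoid_scheme \<Rightarrow> 'g topology \<Rightarrow> bool" where
  "topological_group G T \<longleftrightarrow>
     group G \<and> topspace T = carrier G \<and>
     continuous_map (prod_topology T T) T (\<lambda>(x, y). x \<otimes>\<^bsub>G\<^esub> y) \<and>
     continuous_map T T (\<lambda>x. inv\<^bsub>G\<^esub> x) \<and>
     completely_regular_space T \<and> Hausdorff_space T"

text \<open>The quotient topology on the set \<open>G/H\<close> of left cosets.\<close>

definition coset_topology ::
    "('g, 'm) monoid_scheme \<Rightarrow> 'g topology \<Rightarrow> 'g set \<Rightarrow> 'g set topology" where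
  "coset_topology G T H =
     topology (\<lambda>U. U \<subseteq> lcosets\<^bsub>G\<^esub> H \<and> openin T {x \<in> carrier G. x <#\<^bsub>G\<^esub> H \<in> U})"

lemma openin_coset_topology:
  "openin (coset_topology G T H) U \<longleftrightarrow>
     U \<subseteq> lcosets\<^bsub>G\<^esub> H \<and> openin T {x \<in> carrier G. x <#\<^bsub>G\<^esub> H \<in> U}"
proof -
  let ?P = "\<lambda>U. U \<subseteq> lcosets\<^bsub>G\<^esub> H \<and> openin T {x \<in> carrier G. x <#\<^bsub>G\<^esub> H \<in> U}"
  have "istopology ?P"
    unfolding istopology_def
  proof (intro conjI allI impI)
    fix S U assume S: "?P S" and U: "?P U"
    have "{x \<in> carrier G. x <#\<^bsub>G\<^esub> H \<in> S \<inter> U} =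
        {x \<in> carrier G. x <#\<^bsub>G\<^esub> H \<in> S} \<inter> {x \<in> carrier G. x <#\<^bsub>G\<^esub> H \<in> U}"
      by blast
    then show "openin T {x \<in> carrier G. x <#\<^bsub>G\<^esub> H \<in> S \<inter> U}"
      using S U by (simp add: openin_Int)
    show "S \<inter> U \<subseteq> lcosets\<^bsub>G\<^esub> H" using S by blast
  next
    fix K assume K: "\<forall>S\<in>K. ?P S"
    have "{x \<in> carrier G. x <#\<^bsub>G\<^esub> H \<in> \<Union>K} = (\<Union>S\<in>K. {x \<in> carrier G. x <#\<^bsub>G\<^esub> H \<in> S})"
      by blast
    then show "openin T {x \<in> carrier G. x <#\<^bsub>G\<^esub> H \<in> \<Union>K}"
      using K by auto
    show "\<Union>K \<subseteq> lcosets\<^bsub>G\<^esub> H" using K by blast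
  qed
  then show ?thesis
    by (simp add: coset_topology_def)
qed

lemma topspace_coset_topology:
  assumes "topspace T = carrier G"
  shows "topspace (coset_topology G T H) = lcosets\<^bsub>G\<^esub> H"
proof
  show "topspace (coset_topology G T H) \<subseteq> lcosets\<^bsub>G\<^esub> H"
    using openin_coset_topology[of G T H "topspace (coset_topology G T H)"] by simp
  have "{x \<in> carrier G. x <#\<^bsub>G\<^esub> H \<in> lcosets\<^bsub>G\<^esub> H} = carrier G"
    by (auto simp: LCOSETS_def)
  then have "openin (coset_topology G T H) (lcosets\<^bsub>G\<^esub> H)"
    using assms by (simp add: openin_coset_topology) (metis openin_topspace)
  then show "lcosets\<^bsub>G\<^esub> H \<subseteq> topspace (coset_topology G T H)"
    by (rule openin_subset)
qed

lemma quotient_map_coset_topology: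
  assumes "topspace T = carrier G"
  shows "quotient_map T (coset_topology G T H) (\<lambda>x. x <#\<^bsub>G\<^esub> H)"
  using assms unfolding quotient_map_def
  by (auto simp: topspace_coset_topology openin_coset_topology LCOSETS_def)

definition coset_space :: "'a topology \<Rightarrow> ('g, 'm) monoid_scheme \<Rightarrow> 'g topology \<Rightarrow> bool" where
  "coset_space X G T \<longleftrightarrow>
     topological_group G T \<and>
     (\<exists>H. subgroup H G \<and> closedin T H \<and> X homeomorphic_space coset_topology G T H)"

section \<open>The group of uniform equivalences\<close>

text \<open>As in \<^const>\<open>BijGroup\<close>, self-maps of the underlying set are represented by
  extensional functions, so that distinct group elements are distinct as maps.\<close>

definition uniform_equivalences :: "'a metric \<Rightarrow> ('a \<Rightarrow> 'a) set" where
  "uniform_equivalences m =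
     {f \<in> Bij (mspace m). uniformly_continuous_map m m f \<and>
                         uniformly_continuous_map m m (inv_into (mspace m) f)}"

definition uniform_equivalence_group :: "'a metric \<Rightarrow> ('a \<Rightarrow> 'a) monoid" where
  "uniform_equivalence_group m = (BijGroup (mspace m))\<lparr>carrier := uniform_equivalences m\<rparr>"

lemma uniform_equivalence_group_simps:
  "carrier (uniform_equivalence_group m) = uniform_equivalences m"
  "\<one>\<^bsub>uniform_equivalence_group m\<^esub> = (\<lambda>x\<in>mspace m. x)"
  "\<lbrakk>f \<in> uniform_equivalences m; g \<in> uniform_equivalences m\<rbrakk>
    \<Longrightarrow> f \<otimes>\<^bsub>uniform_equivalence_group m\<^esub> g = compose (mspace m) f g"
  by (auto simp: uniform_equivalence_group_def BijGroup_def uniform_equivalences_def)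

lemma uniformly_continuous_map_cong:
  assumes "\<And>x. x \<in> mspace m \<Longrightarrow> f x = g x"
  shows "uniformly_continuous_map m m' f \<longleftrightarrow> uniformly_continuous_map m m' g"
  using assms by (simp add: uniformly_continuous_map_def Pi_iff)

lemma subgroup_uniform_equivalences:
  "subgroup (uniform_equivalences m) (BijGroup (mspace m))"
proof -
  let ?M = "mspace m"
  interpret B: group "BijGroup ?M" by (rule group_BijGroup)
  have bij: "bij_betw f ?M ?M" if "f \<in> uniform_equivalences m" for f
    using that by (simp add: uniform_equivalences_def Bij_def)
  have inv: "inv\<^bsub>BijGroup ?M\<^esub> f = restrict (inv_into ?M f) ?M" if "f \<in> Bij ?M" for f
    using that inv_BijGroup by fastforce
  show ?thesis
  proof (rule B.subgroupI)
    show "uniform_equivalences m \<subseteq> carrier (BijGroup ?M)"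
      by (auto simp: uniform_equivalences_def BijGroup_def)
    have "inv_into ?M (\<lambda>x\<in>?M. x) x = x" if "x \<in> ?M" for x
      using that by (metis inj_on_restrict_eq inj_on_id2 inv_into_f_f restrict_apply')
    then have "(\<lambda>x\<in>?M. x) \<in> uniform_equivalences m"
      by (auto simp: uniform_equivalences_def id_Bij uniformly_continuous_map_def)
    then show "uniform_equivalences m \<noteq> {}" by blast
  next
    fix f assume f: "f \<in> uniform_equivalences m"
    then have "f \<in> Bij ?M" by (simp add: uniform_equivalences_def)
    have "inv_into ?M (restrict (inv_into ?M f) ?M) x = f x" if "x \<in> ?M" for x
    proof -
      have "inj_on (restrict (inv_into ?M f) ?M) ?M"
        using restrict_inv_into_Bij[OF \<open>f \<in> Bij ?M\<close>] by (simp add: Bij_def bij_betw_def)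
      moreover have "f x \<in> ?M" "restrict (inv_into ?M f) ?M (f x) = x"
        using bij[OF f] that by (auto simp: bij_betw_def)
      ultimately show ?thesis by (metis inv_into_f_f)
    qed
    then show "inv\<^bsub>BijGroup ?M\<^esub> f \<in> uniform_equivalences m"
      using f restrict_inv_into_Bij[OF \<open>f \<in> Bij ?M\<close>]
        uniformly_continuous_map_cong[of m "restrict (inv_into ?M f) ?M" "inv_into ?M f" m]
        uniformly_continuous_map_cong[of m "inv_into ?M (restrict (inv_into ?M f) ?M)" f m]
      by (simp add: inv \<open>f \<in> Bij ?M\<close>) (simp add: uniform_equivalences_def)
  next
    fix f g assume f: "f \<in> uniform_equivalences m" and g: "g \<in> uniform_equivalences m"
    then have fg: "f \<in> Bij ?M" "g \<in> Bij ?M" by (auto simp: uniform_equivalences_def)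
    have c: "compose ?M f g \<in> Bij ?M" using fg by (rule compose_Bij)
    have "inv_into ?M (compose ?M f g) x = inv_into ?M g (inv_into ?M f x)" if x: "x \<in> ?M" for x
    proof -
      have "inv_into ?M f x \<in> ?M" "inv_into ?M g (inv_into ?M f x) \<in> ?M"
        using fg x by (auto intro!: Bij_inv_into_mem)
      moreover have "compose ?M f g (inv_into ?M g (inv_into ?M f x)) = x"
        using bij[OF f] bij[OF g] x calculation by (simp add: compose_def bij_betw_inv_into_right)
      ultimately show ?thesis
        using c by (metis (no_types, lifting) Bij_def Int_iff bij_betw_def inv_into_f_f mem_Collect_eq)
    qed
    then show "f \<otimes>\<^bsub>BijGroup ?M\<^esub> g \<in> uniform_equivalences m"
      using f g fg c
        uniformly_continuous_map_cong[of m "compose ?M f g" "f \<circ> g" m]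
        uniformly_continuous_map_cong[of m "inv_into ?M (compose ?M f g)" "inv_into ?M g \<circ> inv_into ?M f" m]
      by (auto simp: uniform_equivalences_def BijGroup_def compose_eq
          intro: uniformly_continuous_map_compose)
  qed
qed

lemma group_uniform_equivalence_group: "group (uniform_equivalence_group m)"
  unfolding uniform_equivalence_group_def
  by (rule subgroup.subgroup_is_group[OF subgroup_uniform_equivalences group_BijGroup])

lemma inv_uniform_equivalence_group:
  assumes "f \<in> uniform_equivalences m"
  shows "inv\<^bsub>uniform_equivalence_group m\<^esub> f = restrict (inv_into (mspace m) f) (mspace m)"
  using group.m_inv_consistent[OF group_BijGroup subgroup_uniform_equivalences assms] assms
    inv_BijGroup[of f "mspace m"]
  by (simp add: uniform_equivalence_group_def uniform_equivalences_def)

definition uniform_nbhd :: "'a metric \<Rightarrow> real \<Rightarrow> ('a \<Rightarrow> 'a) set" where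
  "uniform_nbhd m \<epsilon> = {g \<in> uniform_equivalences m. \<forall>x \<in> mspace m. mdist m (g x) x < \<epsilon>}"

text \<open>The topology of uniform convergence: the neighborhoods of \<open>f\<close> are the translates of
  the basic neighborhoods of the identity. The lemmas below show that it is a group topology,
  and the only one, in which the sets \<^const>\<open>uniform_nbhd\<close> form a base of neighborhoods
  of the identity.\<close>

definition uniform_convergence_topology :: "'a metric \<Rightarrow> ('a \<Rightarrow> 'a) topology" where
  "uniform_convergence_topology m =
     topology (\<lambda>U. U \<subseteq> uniform_equivalences m \<and>
       (\<forall>f\<in>U. \<exists>\<epsilon>>0. uniform_nbhd m \<epsilon> #>\<^bsub>uniform_equivalence_group m\<^esub> f \<subseteq> U))"

lemma r_coset_uniform_nbhd:
  assumes f: "f \<in> uniform_equivalences m"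
  shows "uniform_nbhd m \<epsilon> #>\<^bsub>uniform_equivalence_group m\<^esub> f =
    {g \<in> uniform_equivalences m. \<forall>x \<in> mspace m. mdist m (g x) (f x) < \<epsilon>}"
    (is "?L = ?R")
proof -
  let ?M = "mspace m"
  interpret U: group "uniform_equivalence_group m" by (rule group_uniform_equivalence_group)
  have bij: "bij_betw f ?M ?M" using f by (simp add: uniform_equivalences_def Bij_def)
  show ?thesis
  proof
    show "?L \<subseteq> ?R"
    proof
      fix g assume "g \<in> ?L"
      then obtain h where h: "h \<in> uniform_nbhd m \<epsilon>" and g: "g = h \<otimes>\<^bsub>uniform_equivalence_group m\<^esub> f"
        by (auto simp: r_coset_def)
      have hU: "h \<in> uniform_equivalences m" using h by (simp add: uniform_nbhd_def)
      have "g \<in> uniform_equivalences m"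
        using U.m_closed[of h f] f hU g by (simp add: uniform_equivalence_group_simps)
      moreover have "g x = h (f x)" if "x \<in> ?M" for x
        using that by (simp add: g uniform_equivalence_group_simps f hU compose_eq)
      ultimately show "g \<in> ?R"
        using h bij by (auto simp: uniform_nbhd_def bij_betw_def)
    qed
    show "?R \<subseteq> ?L"
    proof
      fix g assume g: "g \<in> ?R"
      define h where "h = g \<otimes>\<^bsub>uniform_equivalence_group m\<^esub> inv\<^bsub>uniform_equivalence_group m\<^esub> f"
      have invU: "inv\<^bsub>uniform_equivalence_group m\<^esub> f \<in> uniform_equivalences m"
        using U.inv_closed[of f] f by (simp add: uniform_equivalence_group_simps)
      have hU: "h \<in> uniform_equivalences m"
        using U.m_closed[of g "inv\<^bsub>uniform_equivalence_group m\<^esub> f"] g invU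
        by (simp add: h_def uniform_equivalence_group_simps)
      have "h x = g (inv_into ?M f x)" if "x \<in> ?M" for x
        using that g invU f
        by (simp add: h_def uniform_equivalence_group_simps inv_uniform_equivalence_group compose_eq)
      moreover have "inv_into ?M f x \<in> ?M" "f (inv_into ?M f x) = x" if "x \<in> ?M" for x
        using bij that by (auto simp: bij_betw_inv_into_right bij_betw_def inv_into_into)
      ultimately have "h \<in> uniform_nbhd m \<epsilon>"
        using g hU by (fastforce simp: uniform_nbhd_def)
      moreover have "g = h \<otimes>\<^bsub>uniform_equivalence_group m\<^esub> f"
        using g f U.inv_solve_right[of h g f] U.m_assoc[of g "inv\<^bsub>uniform_equivalence_group m\<^esub> f" f]
          U.l_inv[of f] U.r_one[of g] invU
        by (simp add: h_def uniform_equivalence_group_simps(1))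
      ultimately show "g \<in> ?L" by (auto simp: r_coset_def)
    qed
  qed
qed

lemma openin_uniform_convergence_topology:
  "openin (uniform_convergence_topology m) U \<longleftrightarrow>
     U \<subseteq> uniform_equivalences m \<and>
     (\<forall>f\<in>U. \<exists>\<epsilon>>0. \<forall>g\<in>uniform_equivalences m.
        (\<forall>x\<in>mspace m. mdist m (g x) (f x) < \<epsilon>) \<longrightarrow> g \<in> U)"
proof -
  let ?V = "\<lambda>\<epsilon> f. uniform_nbhd m \<epsilon> #>\<^bsub>uniform_equivalence_group m\<^esub> f"
  let ?P = "\<lambda>U. U \<subseteq> uniform_equivalences m \<and> (\<forall>f\<in>U. \<exists>\<epsilon>>0. ?V \<epsilon> f \<subseteq> U)"
  have mono: "?V \<epsilon> f \<subseteq> ?V \<delta> f" if "\<epsilon> \<le> \<delta>" for \<epsilon> \<delta> f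
    using that by (fastforce simp: r_coset_def uniform_nbhd_def)
  have "istopology ?P"
    unfolding istopology_def
  proof (intro conjI allI impI ballI)
    fix S U f assume S: "?P S" and U: "?P U" and f: "f \<in> S \<inter> U"
    from S U f obtain \<epsilon> \<delta> where "\<epsilon> > 0" "?V \<epsilon> f \<subseteq> S" "\<delta> > 0" "?V \<delta> f \<subseteq> U"
      by (metis IntE)
    then show "\<exists>\<epsilon>>0. ?V \<epsilon> f \<subseteq> S \<inter> U"
      using mono[of "min \<epsilon> \<delta>" \<epsilon> f] mono[of "min \<epsilon> \<delta>" \<delta> f]
      by (intro exI[of _ "min \<epsilon> \<delta>"]) auto
  next
    fix K f assume K: "\<forall>S\<in>K. ?P S" and f: "f \<in> \<Union>K"
    then obtain S \<epsilon> where "S \<in> K" "\<epsilon> > 0" "?V \<epsilon> f \<subseteq> S" by (metis UnionE)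
    then show "\<exists>\<epsilon>>0. ?V \<epsilon> f \<subseteq> \<Union>K" by blast
  qed blast+
  then have *: "openin (uniform_convergence_topology m) U \<longleftrightarrow> ?P U"
    by (simp add: uniform_convergence_topology_def)
  show ?thesis
  proof (cases "U \<subseteq> uniform_equivalences m")
    case True
    then have "?V \<epsilon> f \<subseteq> U \<longleftrightarrow> (\<forall>g\<in>uniform_equivalences m.
        (\<forall>x\<in>mspace m. mdist m (g x) (f x) < \<epsilon>) \<longrightarrow> g \<in> U)" if "f \<in> U" for f \<epsilon>
      using r_coset_uniform_nbhd[of f m \<epsilon>] that by blast
    then show ?thesis unfolding * by blast
  qed (simp add: *)
qed

lemma topspace_uniform_convergence_topology [simp]:
  "topspace (uniform_convergence_topology m) = uniform_equivalences m"
proof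
  show "topspace (uniform_convergence_topology m) \<subseteq> uniform_equivalences m"
    using openin_uniform_convergence_topology openin_topspace by blast
  have "openin (uniform_convergence_topology m) (uniform_equivalences m)"
    unfolding openin_uniform_convergence_topology using zero_less_one by blast
  then show "uniform_equivalences m \<subseteq> topspace (uniform_convergence_topology m)"
    by (rule openin_subset)
qed

lemma metrizable_uniform_convergence_topology:
  "metrizable_space (uniform_convergence_topology m)"
proof -
  let ?M = "mspace m" and ?U = "uniform_equivalences m"
  define D where "D = (\<lambda>f g. Sup (insert 0 ((\<lambda>x. min 1 (mdist m (f x) (g x))) ` ?M)))"
  have maps: "f x \<in> ?M" if "f \<in> ?U" "x \<in> ?M" for f x
    using that by (auto simp: uniform_equivalences_def Bij_def bij_betw_def)
  have bdd: "bdd_above (insert 0 ((\<lambda>x. min 1 (mdist m (f x) (g x))) ` ?M))" for f g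
    by (auto intro!: bdd_aboveI[of _ 1])
  have le_iff: "D f g \<le> c \<longleftrightarrow> 0 \<le> c \<and> (\<forall>x\<in>?M. min 1 (mdist m (f x) (g x)) \<le> c)" for f g c
    unfolding D_def by (subst cSup_le_iff) (use bdd in auto)
  have nonneg: "0 \<le> D f g" for f g using le_iff[of f g "D f g"] by simp
  have le: "min 1 (mdist m (f x) (g x)) \<le> D f g" if "x \<in> ?M" for f g x
    using le_iff[of f g "D f g"] that by simp
  interpret D: Metric_space ?U D
  proof
    fix f g :: "'a \<Rightarrow> 'a"
    show "0 \<le> D f g" by (rule nonneg)
    show "D f g = D g f" by (simp add: D_def mdist_commute)
  next
    fix f g assume f: "f \<in> ?U" and g: "g \<in> ?U"
    have "f = g" if "D f g = 0"
    proof (rule extensionalityI)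
      show "f \<in> extensional ?M" "g \<in> extensional ?M"
        using f g by (auto simp: uniform_equivalences_def Bij_def)
      fix x assume x: "x \<in> ?M"
      then have "mdist m (f x) (g x) \<le> 0" using le[of x f g] that by auto
      then show "f x = g x" using maps f g x by (metis mdist_nonneg mdist_zero order_antisym)
    qed
    moreover have "D f f = 0"
      using nonneg[of f f] le_iff[of f f 0] maps[OF f] mdist_zero[of "f _" m "f _"] by fastforce
    ultimately show "D f g = 0 \<longleftrightarrow> f = g" by blast
  next
    fix f g h assume f: "f \<in> ?U" and g: "g \<in> ?U" and h: "h \<in> ?U"
    have "min 1 (mdist m (f x) (h x)) \<le> D f g + D g h" if x: "x \<in> ?M" for x
      using le[OF x, of f g] le[OF x, of g h] mdist_triangle[of "f x" m "g x" "h x"]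
        maps[OF f x] maps[OF g x] maps[OF h x] mdist_nonneg[of m "f x" "g x"]
        mdist_nonneg[of m "g x" "h x"] by linarith
    then show "D f h \<le> D f g + D g h" using nonneg by (simp add: le_iff)
  qed
  have "openin (uniform_convergence_topology m) W \<longleftrightarrow> openin D.mtopology W" for W
  proof -
    have "(\<exists>\<epsilon>>0. \<forall>g\<in>?U. (\<forall>x\<in>?M. mdist m (g x) (f x) < \<epsilon>) \<longrightarrow> g \<in> W) \<longleftrightarrow>
        (\<exists>r>0. D.mball f r \<subseteq> W)" if f: "f \<in> ?U" for f
    proof
      assume "\<exists>\<epsilon>>0. \<forall>g\<in>?U. (\<forall>x\<in>?M. mdist m (g x) (f x) < \<epsilon>) \<longrightarrow> g \<in> W"
      then obtain \<epsilon> where e: "\<epsilon> > 0" "\<And>g. g \<in> ?U \<Longrightarrow> (\<forall>x\<in>?M. mdist m (g x) (f x) < \<epsilon>) \<Longrightarrow> g \<in> W"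
        by blast
      have "D.mball f (min 1 \<epsilon>) \<subseteq> W"
      proof
        fix g assume "g \<in> D.mball f (min 1 \<epsilon>)"
        then have g: "g \<in> ?U" "D f g < min 1 \<epsilon>" by (auto simp: D.in_mball)
        have "mdist m (g x) (f x) < \<epsilon>" if "x \<in> ?M" for x
          using le[OF that, of f g] g(2) mdist_commute[of m "g x" "f x"] by linarith
        then show "g \<in> W" using e g by blast
      qed
      then show "\<exists>r>0. D.mball f r \<subseteq> W" using e by (intro exI[of _ "min 1 \<epsilon>"]) auto
    next
      assume "\<exists>r>0. D.mball f r \<subseteq> W"
      then obtain r where r: "r > 0" "D.mball f r \<subseteq> W" by blast
      have "g \<in> W" if g: "g \<in> ?U" "\<forall>x\<in>?M. mdist m (g x) (f x) < r/2" for g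
      proof -
        have "D f g \<le> r/2"
          unfolding le_iff
        proof (intro conjI ballI)
          fix x assume "x \<in> ?M"
          then show "min 1 (mdist m (f x) (g x)) \<le> r/2"
            using g(2) mdist_commute[of m "f x" "g x"] by (metis less_imp_le min.coboundedI2)
        qed (use r in simp)
        then have "g \<in> D.mball f r" using f g r by (simp add: D.in_mball)
        then show ?thesis using r by blast
      qed
      then show "\<exists>\<epsilon>>0. \<forall>g\<in>?U. (\<forall>x\<in>?M. mdist m (g x) (f x) < \<epsilon>) \<longrightarrow> g \<in> W"
        using r(1) by (intro exI[of _ "r/2"]) auto
    qed
    then have "(\<forall>f\<in>W. \<exists>\<epsilon>>0. \<forall>g\<in>?U. (\<forall>x\<in>?M. mdist m (g x) (f x) < \<epsilon>) \<longrightarrow> g \<in> W) \<longleftrightarrow>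
        (\<forall>f\<in>W. \<exists>r>0. D.mball f r \<subseteq> W)" if "W \<subseteq> ?U"
      using that by (intro ball_cong refl) (simp only: subsetD)
    then show ?thesis
      by (simp only: openin_uniform_convergence_topology D.openin_mtopology flip: Ball_def)
        (rule conj_cong[OF refl])
  qed
  then have "uniform_convergence_topology m = D.mtopology"
    by (simp add: topology_eq)
  then show ?thesis by (simp add: D.metrizable_space_mtopology)
qed

lemma uniform_nbhd_contains_open:
  assumes f: "f \<in> uniform_equivalences m" and "\<epsilon> > 0"
  shows "\<exists>W. openin (uniform_convergence_topology m) W \<and> f \<in> W \<and>
     W \<subseteq> {g \<in> uniform_equivalences m. \<forall>x \<in> mspace m. mdist m (g x) (f x) < \<epsilon>}"
proof -
  let ?M = "mspace m" and ?U = "uniform_equivalences m"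
  have maps: "f x \<in> ?M" if "f \<in> ?U" "x \<in> ?M" for f x
    using that by (auto simp: uniform_equivalences_def Bij_def bij_betw_def)
  define W where "W = {g \<in> ?U. \<exists>\<delta><\<epsilon>. \<forall>x \<in> ?M. mdist m (g x) (f x) \<le> \<delta>}"
  have "openin (uniform_convergence_topology m) W"
    unfolding openin_uniform_convergence_topology
  proof (intro conjI ballI)
    show "W \<subseteq> ?U" by (auto simp: W_def)
    fix g assume "g \<in> W"
    then obtain \<delta> where g: "g \<in> ?U" and d: "\<delta> < \<epsilon>" "\<And>x. x \<in> ?M \<Longrightarrow> mdist m (g x) (f x) \<le> \<delta>"
      by (auto simp: W_def)
    have "h \<in> W" if h: "h \<in> ?U" "\<forall>x\<in>?M. mdist m (h x) (g x) < (\<epsilon> - \<delta>) / 2" for h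
    proof -
      have "mdist m (h x) (f x) \<le> (\<epsilon> + \<delta>) / 2" if x: "x \<in> ?M" for x
      proof -
        have "mdist m (h x) (f x) \<le> mdist m (h x) (g x) + mdist m (g x) (f x)"
          using maps h f g x by (intro mdist_triangle) auto
        also have "\<dots> \<le> (\<epsilon> - \<delta>) / 2 + \<delta>" using h(2) d(2) x by (intro add_mono) (auto intro: less_imp_le)
        finally show ?thesis by (simp add: field_simps)
      qed
      then show ?thesis using h d unfolding W_def
        by (auto intro!: exI[of _ "(\<epsilon> + \<delta>) / 2"])
    qed
    then show "\<exists>\<epsilon>>0. \<forall>h\<in>?U. (\<forall>x\<in>?M. mdist m (h x) (g x) < \<epsilon>) \<longrightarrow> h \<in> W"
      using d by (intro exI[of _ "(\<epsilon> - \<delta>) / 2"]) auto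
  qed
  moreover have "f \<in> W" using f \<open>\<epsilon> > 0\<close> maps[OF f] by (auto simp: W_def mdist_zero[THEN iffD2] intro!: exI[of _ 0])
  moreover have "W \<subseteq> {g \<in> ?U. \<forall>x \<in> ?M. mdist m (g x) (f x) < \<epsilon>}"
    unfolding W_def using le_less_trans by blast
  ultimately show ?thesis by blast
qed

lemma topological_group_uniform_equivalence_group:
  "topological_group (uniform_equivalence_group m) (uniform_convergence_topology m)"
proof -
  let ?M = "mspace m" and ?U = "uniform_equivalences m"
  let ?G = "uniform_equivalence_group m" and ?T = "uniform_convergence_topology m"
  interpret U: group ?G by (rule group_uniform_equivalence_group)
  have maps: "f x \<in> ?M" if "f \<in> ?U" "x \<in> ?M" for f x
    using that by (auto simp: uniform_equivalences_def Bij_def bij_betw_def)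
  have mult: "f \<otimes>\<^bsub>?G\<^esub> g \<in> ?U" if "f \<in> ?U" "g \<in> ?U" for f g
    using that U.m_closed[of f g] by (simp add: uniform_equivalence_group_simps)
  have inv: "inv\<^bsub>?G\<^esub> f \<in> ?U" if "f \<in> ?U" for f
    using that U.inv_closed[of f] by (simp add: uniform_equivalence_group_simps)
  have cmult: "continuous_map (prod_topology ?T ?T) ?T (\<lambda>(x, y). x \<otimes>\<^bsub>?G\<^esub> y)"
    unfolding continuous_map_def
  proof (intro conjI allI impI)
    show "(\<lambda>(x, y). x \<otimes>\<^bsub>?G\<^esub> y) \<in> topspace (prod_topology ?T ?T) \<rightarrow> topspace ?T"
      using mult by auto
    fix W assume W: "openin ?T W"
    have "\<exists>A B. openin ?T A \<and> openin ?T B \<and> f \<in> A \<and> g \<in> B \<and>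
        A \<times> B \<subseteq> {x \<in> topspace (prod_topology ?T ?T). (case x of (x, y) \<Rightarrow> x \<otimes>\<^bsub>?G\<^esub> y) \<in> W}"
      if f: "f \<in> ?U" and g: "g \<in> ?U" and fg: "f \<otimes>\<^bsub>?G\<^esub> g \<in> W" for f g
    proof -
      obtain \<epsilon> where e: "\<epsilon> > 0"
        and eW: "\<And>h. \<lbrakk>h \<in> ?U; \<forall>x\<in>?M. mdist m (h x) ((f \<otimes>\<^bsub>?G\<^esub> g) x) < \<epsilon>\<rbrakk> \<Longrightarrow> h \<in> W"
        using W fg unfolding openin_uniform_convergence_topology by meson
      have "uniformly_continuous_map m m f" using f by (simp add: uniform_equivalences_def)
      then obtain \<delta> where d: "\<delta> > 0"
        and fd: "\<And>x y. \<lbrakk>x \<in> ?M; y \<in> ?M; mdist m y x < \<delta>\<rbrakk> \<Longrightarrow> mdist m (f y) (f x) < \<epsilon>/2"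
        unfolding uniformly_continuous_map_def using e by (meson half_gt_zero)
      obtain A where A: "openin ?T A" "f \<in> A"
        "A \<subseteq> {h \<in> ?U. \<forall>x \<in> ?M. mdist m (h x) (f x) < \<epsilon>/2}"
        using uniform_nbhd_contains_open[OF f, of "\<epsilon>/2"] e by auto
      obtain B where B: "openin ?T B" "g \<in> B"
        "B \<subseteq> {h \<in> ?U. \<forall>x \<in> ?M. mdist m (h x) (g x) < \<delta>}"
        using uniform_nbhd_contains_open[OF g d] by blast
      have "a \<otimes>\<^bsub>?G\<^esub> b \<in> W" if a: "a \<in> A" and b: "b \<in> B" for a b
      proof (rule eW)
        have aU: "a \<in> ?U" and bU: "b \<in> ?U" using a b A B by auto
        then show "a \<otimes>\<^bsub>?G\<^esub> b \<in> ?U" by (rule mult)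
        show "\<forall>x\<in>?M. mdist m ((a \<otimes>\<^bsub>?G\<^esub> b) x) ((f \<otimes>\<^bsub>?G\<^esub> g) x) < \<epsilon>"
        proof
          fix x assume x: "x \<in> ?M"
          have "mdist m (a (b x)) (f (g x)) \<le> mdist m (a (b x)) (f (b x)) + mdist m (f (b x)) (f (g x))"
            using maps aU bU f g x by (intro mdist_triangle) auto
          also have "\<dots> < \<epsilon>/2 + \<epsilon>/2"
          proof (rule add_strict_mono)
            show "mdist m (a (b x)) (f (b x)) < \<epsilon>/2" using a A(3) maps[OF bU x] by blast
            show "mdist m (f (b x)) (f (g x)) < \<epsilon>/2"
              using b B(3) x by (intro fd maps[OF g x] maps[OF bU x]) auto
          qed
          finally show "mdist m ((a \<otimes>\<^bsub>?G\<^esub> b) x) ((f \<otimes>\<^bsub>?G\<^esub> g) x) < \<epsilon>"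
            using x aU bU f g by (simp add: uniform_equivalence_group_simps compose_eq)
        qed
      qed
      then have "A \<times> B \<subseteq> {x \<in> topspace (prod_topology ?T ?T). (case x of (x, y) \<Rightarrow> x \<otimes>\<^bsub>?G\<^esub> y) \<in> W}"
        using openin_subset[OF A(1)] openin_subset[OF B(1)] by auto
      then show ?thesis using A(1,2) B(1,2) by blast
    qed
    then show "openin (prod_topology ?T ?T)
        {x \<in> topspace (prod_topology ?T ?T). (case x of (x, y) \<Rightarrow> x \<otimes>\<^bsub>?G\<^esub> y) \<in> W}"
      unfolding openin_prod_topology_alt by simp
  qed
  have cinv: "continuous_map ?T ?T (\<lambda>x. inv\<^bsub>?G\<^esub> x)"
    unfolding continuous_map_def
  proof (intro conjI allI impI)
    show "(\<lambda>x. inv\<^bsub>?G\<^esub> x) \<in> topspace ?T \<rightarrow> topspace ?T" using inv by auto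
    fix W assume W: "openin ?T W"
    show "openin ?T {f \<in> topspace ?T. inv\<^bsub>?G\<^esub> f \<in> W}"
      unfolding openin_uniform_convergence_topology
    proof (intro conjI ballI)
      fix f assume "f \<in> {f \<in> topspace ?T. inv\<^bsub>?G\<^esub> f \<in> W}"
      then have f: "f \<in> ?U" "inv\<^bsub>?G\<^esub> f \<in> W" by auto
      obtain \<epsilon> where e: "\<epsilon> > 0"
        and eW: "\<And>h. \<lbrakk>h \<in> ?U; \<forall>x\<in>?M. mdist m (h x) ((inv\<^bsub>?G\<^esub> f) x) < \<epsilon>\<rbrakk> \<Longrightarrow> h \<in> W"
        using W f unfolding openin_uniform_convergence_topology by meson
      have "uniformly_continuous_map m m (inv_into ?M f)"
        using f by (simp add: uniform_equivalences_def)
      then obtain \<delta> where d: "\<delta> > 0"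
        and fd: "\<And>x y. \<lbrakk>x \<in> ?M; y \<in> ?M; mdist m y x < \<delta>\<rbrakk>
          \<Longrightarrow> mdist m (inv_into ?M f y) (inv_into ?M f x) < \<epsilon>"
        unfolding uniformly_continuous_map_def using e by meson
      have "inv\<^bsub>?G\<^esub> g \<in> W" if g: "g \<in> ?U" "\<forall>x\<in>?M. mdist m (g x) (f x) < \<delta>" for g
      proof (rule eW)
        show "inv\<^bsub>?G\<^esub> g \<in> ?U" by (rule inv) (rule g)
        show "\<forall>x\<in>?M. mdist m ((inv\<^bsub>?G\<^esub> g) x) ((inv\<^bsub>?G\<^esub> f) x) < \<epsilon>"
        proof
          fix x assume x: "x \<in> ?M"
          define y where "y = inv_into ?M g x"
          have bij: "bij_betw f ?M ?M" "bij_betw g ?M ?M"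
            using f g by (auto simp: uniform_equivalences_def Bij_def)
          have y: "y \<in> ?M" "g y = x" using bij x
            by (auto simp: y_def bij_betw_inv_into_right bij_betw_def inv_into_into)
          have fy: "inv_into ?M f (f y) = y" using bij y by (simp add: bij_betw_inv_into_left)
          have "mdist m (f y) x < \<delta>" using g(2) y mdist_commute by metis
          then have "mdist m (inv_into ?M f (f y)) (inv_into ?M f x) < \<epsilon>"
            using maps[OF f(1) y(1)] x by (intro fd)
          then show "mdist m ((inv\<^bsub>?G\<^esub> g) x) ((inv\<^bsub>?G\<^esub> f) x) < \<epsilon>"
            using x f g by (simp add: fy inv_uniform_equivalence_group flip: y_def)
        qed
      qed
      then show "\<exists>\<epsilon>>0. \<forall>g\<in>?U. (\<forall>x\<in>?M. mdist m (g x) (f x) < \<epsilon>) \<longrightarrow>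
          g \<in> {f \<in> topspace ?T. inv\<^bsub>?G\<^esub> f \<in> W}"
        using d by (intro exI[of _ \<delta>]) auto
    qed auto
  qed
  show ?thesis
    unfolding topological_group_def
    using cmult cinv U.group_axioms
      metrizable_imp_completely_regular_space[OF metrizable_uniform_convergence_topology[of m]]
      metrizable_imp_Hausdorff_space[OF metrizable_uniform_convergence_topology[of m]]
    by (simp add: uniform_equivalence_group_simps(1))
qed

text \<open>The neighborhoods of the identity are exactly the supersets of some \<^term>\<open>uniform_nbhd m \<epsilon>\<close>.\<close>

definition uniform_nbhd_base :: "'a metric \<Rightarrow> ('a \<Rightarrow> 'a) topology \<Rightarrow> bool" where
  "uniform_nbhd_base m T \<longleftrightarrow>
     (\<forall>N. (\<exists>W. openin T W \<and> \<one>\<^bsub>uniform_equivalence_group m\<^esub> \<in> W \<and> W \<subseteq> N) \<longleftrightarrow>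
       (\<exists>\<epsilon>>0. uniform_nbhd m \<epsilon> \<subseteq> N))"

lemma uniform_nbhd_base_uniform_convergence_topology:
  "uniform_nbhd_base m (uniform_convergence_topology m)"
proof -
  let ?G = "uniform_equivalence_group m" and ?T = "uniform_convergence_topology m"
  interpret U: group ?G by (rule group_uniform_equivalence_group)
  have 1: "\<one>\<^bsub>?G\<^esub> \<in> uniform_equivalences m"
    using U.one_closed by (simp add: uniform_equivalence_group_simps(1))
  have *: "uniform_nbhd m \<epsilon> = {g \<in> uniform_equivalences m. \<forall>x \<in> mspace m. mdist m (g x) (\<one>\<^bsub>?G\<^esub> x) < \<epsilon>}" for \<epsilon>
    by (auto simp: uniform_nbhd_def uniform_equivalence_group_simps)
  have "\<exists>\<epsilon>>0. uniform_nbhd m \<epsilon> \<subseteq> N" if "openin ?T W" "\<one>\<^bsub>?G\<^esub> \<in> W" "W \<subseteq> N" for N W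
  proof -
    from that obtain \<epsilon> where "\<epsilon> > 0" "\<forall>g\<in>uniform_equivalences m.
        (\<forall>x\<in>mspace m. mdist m (g x) (\<one>\<^bsub>?G\<^esub> x) < \<epsilon>) \<longrightarrow> g \<in> W"
      unfolding openin_uniform_convergence_topology by meson
    then show ?thesis using that(3) by (intro exI[of _ \<epsilon>]) (auto simp: *)
  qed
  note 2 = this
  have 3: "\<exists>W. openin ?T W \<and> \<one>\<^bsub>?G\<^esub> \<in> W \<and> W \<subseteq> N" if "\<epsilon> > 0" "uniform_nbhd m \<epsilon> \<subseteq> N" for N \<epsilon>
    using uniform_nbhd_contains_open[OF 1 that(1)] that(2) unfolding * by (meson order_trans)
  show ?thesis
    unfolding uniform_nbhd_base_def
  proof (intro allI iffI)
    fix N assume "\<exists>W. openin ?T W \<and> \<one>\<^bsub>?G\<^esub> \<in> W \<and> W \<subseteq> N"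
    then show "\<exists>\<epsilon>>0. uniform_nbhd m \<epsilon> \<subseteq> N" by (elim exE conjE) (rule 2)
  next
    fix N assume "\<exists>\<epsilon>>0. uniform_nbhd m \<epsilon> \<subseteq> N"
    then show "\<exists>W. openin ?T W \<and> \<one>\<^bsub>?G\<^esub> \<in> W \<and> W \<subseteq> N" by (elim exE conjE) (rule 3)
  qed
qed

lemma uniform_convergence_topology_unique:
  assumes T: "topological_group (uniform_equivalence_group m) T" and base: "uniform_nbhd_base m T"
  shows "T = uniform_convergence_topology m"
proof -
  let ?G = "uniform_equivalence_group m" and ?U = "uniform_equivalences m"
  interpret U: group ?G by (rule group_uniform_equivalence_group)
  have c: "carrier ?G = ?U" by (rule uniform_equivalence_group_simps(1))
  have open_iff: "openin S W \<longleftrightarrow> W \<subseteq> ?U \<and> (\<forall>f\<in>W. \<exists>\<epsilon>>0. uniform_nbhd m \<epsilon> #>\<^bsub>?G\<^esub> f \<subseteq> W)"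
    if S: "topological_group ?G S" and b: "uniform_nbhd_base m S" for S W
  proof -
    have tS: "topspace S = ?U" and mS: "continuous_map (prod_topology S S) S (\<lambda>(x, y). x \<otimes>\<^bsub>?G\<^esub> y)"
      using S by (simp_all only: topological_group_def c)
    have b1: "\<exists>\<epsilon>>0. uniform_nbhd m \<epsilon> \<subseteq> N" if "openin S N" "\<one>\<^bsub>?G\<^esub> \<in> N" for N
      using b[unfolded uniform_nbhd_base_def, rule_format, of N] that by blast
    have b2: "\<exists>N. openin S N \<and> \<one>\<^bsub>?G\<^esub> \<in> N \<and> N \<subseteq> uniform_nbhd m \<epsilon>" if "\<epsilon> > 0" for \<epsilon>
      using b[unfolded uniform_nbhd_base_def, rule_format, of "uniform_nbhd m \<epsilon>"] that by blast
    have tr: "continuous_map S S (\<lambda>x. x \<otimes>\<^bsub>?G\<^esub> f)" if "f \<in> ?U" for f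
    proof -
      have "continuous_map S (prod_topology S S) (\<lambda>x. (x, f))"
        using that tS by (intro continuous_map_pairedI) auto
      from continuous_map_compose[OF this mS] show ?thesis by (simp add: comp_def)
    qed
    show ?thesis
    proof (intro iffI conjI ballI)
      assume W: "openin S W"
      then show "W \<subseteq> ?U" using openin_subset tS by blast
      fix f assume f: "f \<in> W"
      with \<open>W \<subseteq> ?U\<close> have fU: "f \<in> ?U" by blast
      have "openin S {x \<in> ?U. x \<otimes>\<^bsub>?G\<^esub> f \<in> W}"
        using openin_continuous_map_preimage[OF tr[OF fU] W] tS by simp
      moreover have "\<one>\<^bsub>?G\<^esub> \<in> {x \<in> ?U. x \<otimes>\<^bsub>?G\<^esub> f \<in> W}" using f fU U.one_closed by (simp add: c)
      ultimately obtain \<epsilon> where "\<epsilon> > 0" "uniform_nbhd m \<epsilon> \<subseteq> {x \<in> ?U. x \<otimes>\<^bsub>?G\<^esub> f \<in> W}"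
        using b1 by meson
      then show "\<exists>\<epsilon>>0. uniform_nbhd m \<epsilon> #>\<^bsub>?G\<^esub> f \<subseteq> W"
        by (intro exI[of _ \<epsilon>]) (auto simp: r_coset_def)
    next
      assume W: "W \<subseteq> ?U \<and> (\<forall>f\<in>W. \<exists>\<epsilon>>0. uniform_nbhd m \<epsilon> #>\<^bsub>?G\<^esub> f \<subseteq> W)"
      show "openin S W"
      proof (subst openin_subopen, intro ballI)
        fix f assume f: "f \<in> W"
        then have fU: "f \<in> ?U" using W by blast
        obtain \<epsilon> where e: "\<epsilon> > 0" "uniform_nbhd m \<epsilon> #>\<^bsub>?G\<^esub> f \<subseteq> W" using W f by blast
        then obtain N where N: "openin S N" "\<one>\<^bsub>?G\<^esub> \<in> N" "N \<subseteq> uniform_nbhd m \<epsilon>"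
          using b2 by meson
        have iU: "inv\<^bsub>?G\<^esub> f \<in> ?U" using U.inv_closed[of f] fU by (simp add: c)
        let ?N = "{x \<in> topspace S. x \<otimes>\<^bsub>?G\<^esub> inv\<^bsub>?G\<^esub> f \<in> N}"
        have "openin S ?N" by (rule openin_continuous_map_preimage[OF tr[OF iU] N(1)])
        moreover have "f \<in> ?N" using fU N(2) U.r_inv[of f] by (simp add: tS c)
        moreover have "?N \<subseteq> W"
        proof
          fix x assume x: "x \<in> ?N"
          then have xU: "x \<in> ?U" by (simp add: tS)
          have "x = (x \<otimes>\<^bsub>?G\<^esub> inv\<^bsub>?G\<^esub> f) \<otimes>\<^bsub>?G\<^esub> f"
            using xU fU iU by (simp add: U.m_assoc c U.l_inv U.r_one)
          then have "x \<in> uniform_nbhd m \<epsilon> #>\<^bsub>?G\<^esub> f" using x N(3) unfolding r_coset_def by blast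
          then show "x \<in> W" using e by blast
        qed
        ultimately show "\<exists>V. openin S V \<and> f \<in> V \<and> V \<subseteq> W" by blast
      qed
    qed
  qed
  show ?thesis
    unfolding topology_eq
    by (simp only: open_iff[OF T base] open_iff[OF topological_group_uniform_equivalence_group
        uniform_nbhd_base_uniform_convergence_topology] simp_thms)
qed

section \<open>The conditions of the theorem\<close>

text \<open>Quantification over all groups cannot range over all types, so the type of the
  group elements is an explicit parameter.\<close>

definition coset_space_of_metrizable_group :: "'g itself \<Rightarrow> 'a topology \<Rightarrow> bool" where
  "coset_space_of_metrizable_group TYPE('g) X \<longleftrightarrow>
     (\<exists>(G :: 'g monoid) T. metrizable_space T \<and> coset_space X G T)"

definition coset_space_of_separable_metrizable_group :: "'g itself \<Rightarrow> 'a topology \<Rightarrow> bool" where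
  "coset_space_of_separable_metrizable_group TYPE('g) X \<longleftrightarrow>
     (\<exists>(G :: 'g monoid) T. separable_space T \<and> metrizable_space T \<and> coset_space X G T)"

definition coset_space_of_uniform_equivalences :: "'a topology \<Rightarrow> bool" where
  "coset_space_of_uniform_equivalences X \<longleftrightarrow>
     (\<exists>m. mtopology_of m = X \<and>
        coset_space X (uniform_equivalence_group m) (uniform_convergence_topology m))"

definition coset_space_of_totally_bounded_uniform_equivalences :: "'a topology \<Rightarrow> bool" where
  "coset_space_of_totally_bounded_uniform_equivalences X \<longleftrightarrow>
     (\<exists>m. mtopology_of m = X \<and>
        Metric_space.mtotally_bounded (mspace m) (mdist m) (mspace m) \<and>
        coset_space X (uniform_equivalence_group m) (uniform_convergence_topology m))"

end

theory Submission
  imports Defs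
begin

text \<open>The implication from uniform equivalences to metrizable groups is witnessed by the group of
uniform equivalences itself: its topology is always metrizable, and it is separable as soon as the
metric is totally bounded, because an equivalence is then determined up to \<open>\<epsilon>\<close> by a finite amount
of data, namely a modulus of continuity and approximate values on a finite net
(\<open>separable_uniform_convergence_topology\<close>).

For the converse, let \<open>X\<close> be the coset space \<open>G/H\<close> and let \<open>G\<close> act on it by left translations.
The proof isolates what a metric on \<open>X\<close> has to satisfy: every translation is uniformly continuous,
and translations by elements close to the identity move all points uniformly little. With
such an \<^emph>\<open>admissible\<close> metric the action is a continuous homomorphism from \<open>G\<close> to the group \<open>U\<close> of
uniform equivalences. Hence \<open>U\<close> acts transitively, and an orbit map \<open>f \<mapsto> f x\<^sub>0\<close> of \<open>U\<close> is open because
the orbit map of \<open>G\<close>, which is open, factors through it. So \<open>X\<close> is the quotient of \<open>U\<close> by a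
stabilizer (\<open>coset_space_uniform_equivalences\<close>).

An admissible metric always exists when \<open>G\<close> is metrizable. By the Birkhoff-Kakutani construction
\<open>G\<close> carries a symmetric subadditive function \<open>N\<close> whose sublevel sets are a base of neighborhoods of
the identity, and \<open>\<rho>(u, v) = inf {N z | z u = v}\<close> is the desired metric; translations are uniformly
continuous since conjugations are continuous at the identity (\<open>exists_admissible_metric\<close>).

When \<open>G\<close> and \<open>X\<close> are separable, \<open>\<rho>\<close> is replaced by a totally bounded metric. Take countable dense sets
\<open>A\<close> in \<open>X\<close> and \<open>Q\<close> in \<open>G\<close> and embed \<open>X\<close> in the Hilbert cube by the countably many functions
\<open>u \<mapsto> min 1 (\<rho> (q u) a)\<close> with \<open>a \<in> A\<close> and \<open>q \<in> Q\<close>. The translate of such a function by an arbitrary \<open>g\<close>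
is a uniform limit of functions of the family, because \<open>q g\<close> is a limit of elements of \<open>Q\<close> and
nearby group elements act uniformly closely. This keeps all translations uniformly continuous for
the metric of the Hilbert cube (\<open>exists_totally_bounded_admissible_metric\<close>).\<close>

section \<open>Translations in topological groups\<close>

lemma topological_groupD:
  assumes "topological_group G T"
  shows "group G" "topspace T = carrier G"
    "continuous_map (prod_topology T T) T (\<lambda>(x, y). x \<otimes>\<^bsub>G\<^esub> y)"
    "continuous_map T T (\<lambda>x. inv\<^bsub>G\<^esub> x)"
  using assms by (auto simp: topological_group_def)

lemma continuous_map_group_mult:
  assumes "topological_group G T" "continuous_map S T f" "continuous_map S T g"
  shows "continuous_map S T (\<lambda>x. f x \<otimes>\<^bsub>G\<^esub> g x)"
proof -
  have "continuous_map S (prod_topology T T) (\<lambda>x. (f x, g x))"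
    using assms by (simp add: continuous_map_pairedI)
  from continuous_map_compose[OF this topological_groupD(3)[OF assms(1)]] show ?thesis
    by (simp add: comp_def)
qed

lemma openin_right_translate:
  assumes T: "topological_group G T" and W: "openin T W" and g: "g \<in> carrier G"
  shows "openin T ((\<lambda>w. w \<otimes>\<^bsub>G\<^esub> g) ` W)"
proof -
  interpret group G using T by (rule topological_groupD)
  have ts: "topspace T = carrier G" using T by (rule topological_groupD)
  have WG: "W \<subseteq> carrier G" using openin_subset[OF W] ts by simp
  have "continuous_map T T (\<lambda>x. x \<otimes>\<^bsub>G\<^esub> inv\<^bsub>G\<^esub> g)"
    using g ts by (intro continuous_map_group_mult[OF T]) auto
  then have "openin T {x \<in> topspace T. x \<otimes>\<^bsub>G\<^esub> inv\<^bsub>G\<^esub> g \<in> W}"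
    using W by (rule openin_continuous_map_preimage)
  moreover have "{x \<in> topspace T. x \<otimes>\<^bsub>G\<^esub> inv\<^bsub>G\<^esub> g \<in> W} = (\<lambda>w. w \<otimes>\<^bsub>G\<^esub> g) ` W"
  proof (intro equalityI subsetI)
    fix x assume "x \<in> {x \<in> topspace T. x \<otimes>\<^bsub>G\<^esub> inv\<^bsub>G\<^esub> g \<in> W}"
    then have "x = (x \<otimes>\<^bsub>G\<^esub> inv\<^bsub>G\<^esub> g) \<otimes>\<^bsub>G\<^esub> g" "x \<otimes>\<^bsub>G\<^esub> inv\<^bsub>G\<^esub> g \<in> W"
      using g ts by (auto simp: m_assoc)
    then show "x \<in> (\<lambda>w. w \<otimes>\<^bsub>G\<^esub> g) ` W" by blast
  qed (use WG g ts in \<open>auto simp: m_assoc\<close>)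
  ultimately show ?thesis by simp
qed

section \<open>Coset spaces as open equivariant images of the group\<close>

text \<open>To say that \<open>X\<close> is the coset space \<open>G/H\<close> is to give an open continuous surjection from \<open>G\<close> onto \<open>X\<close>
whose fibres are the left cosets of \<open>H\<close>. This form avoids sets of cosets and applies to orbit
maps directly.\<close>

locale coset_parametrization = group G for G (structure) +
  fixes T :: "'a topology" and X :: "'b topology" and H :: "'a set" and p :: "'a \<Rightarrow> 'b"
  assumes topological_group: "topological_group G T"
    and subgroup: "subgroup H G"
    and continuous: "continuous_map T X p"
    and open_map: "open_map T X p"
    and surj: "p ` carrier G = topspace X"
    and fibres: "\<lbrakk>x \<in> carrier G; y \<in> carrier G\<rbrakk> \<Longrightarrow> p x = p y \<longleftrightarrow> inv x \<otimes> y \<in> H"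
begin

lemma topspace: "topspace T = carrier G"
  using topological_group by (rule topological_groupD)

lemma p_closed [simp]: "x \<in> carrier G \<Longrightarrow> p x \<in> topspace X"
  using surj by blast

lemma point_cases:
  assumes "u \<in> topspace X"
  obtains x where "x \<in> carrier G" "u = p x"
  using assms surj by blast

lemma left_mult_fibre:
  assumes "g \<in> carrier G" "x \<in> carrier G" "y \<in> carrier G" "p x = p y"
  shows "p (g \<otimes> x) = p (g \<otimes> y)"
proof -
  have "inv (g \<otimes> x) \<otimes> (g \<otimes> y) = inv x \<otimes> y"
    using assms by (simp add: inv_mult_group m_assoc inv_solve_left')
  then show ?thesis using assms fibres by simp
qed

text \<open>The left translation by \<open>g\<close>, transported to \<open>X\<close>; the chosen representative is immaterial because left
translations permute the cosets.\<close>

definition act :: "'a \<Rightarrow> 'b \<Rightarrow> 'b" where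
  "act g u = p (g \<otimes> (SOME x. x \<in> carrier G \<and> p x = u))"

lemma act_p:
  assumes "g \<in> carrier G" "x \<in> carrier G"
  shows "act g (p x) = p (g \<otimes> x)"
proof -
  have "(SOME y. y \<in> carrier G \<and> p y = p x) \<in> carrier G \<and> p (SOME y. y \<in> carrier G \<and> p y = p x) = p x"
    by (rule someI[of _ x]) (use assms in simp)
  then show ?thesis unfolding act_def using assms left_mult_fibre by blast
qed

lemma act_closed: "\<lbrakk>g \<in> carrier G; u \<in> topspace X\<rbrakk> \<Longrightarrow> act g u \<in> topspace X"
  by (erule point_cases) (simp add: act_p)

lemma act_one: "u \<in> topspace X \<Longrightarrow> act \<one> u = u"
  by (erule point_cases) (simp add: act_p)

lemma act_mult: "\<lbrakk>g \<in> carrier G; h \<in> carrier G; u \<in> topspace X\<rbrakk> \<Longrightarrow> act (g \<otimes> h) u = act g (act h u)"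
  by (erule point_cases) (simp add: act_p m_assoc)

lemma act_inv:
  assumes "g \<in> carrier G" "u \<in> topspace X"
  shows "act (inv g) (act g u) = u" "act g (act (inv g) u) = u"
  using assms act_mult[of "inv g" g u] act_mult[of g "inv g" u] by (simp_all add: act_one)

text \<open>The subgroup is the fibre over the image of the identity.\<close>

lemma closedin_subgroup:
  assumes "t1_space X"
  shows "closedin T H"
proof -
  have "closedin X {p \<one>}" using assms by (simp add: closedin_t1_singleton)
  then have "closedin T {x \<in> topspace T. p x \<in> {p \<one>}}"
    by (rule closedin_continuous_map_preimage[OF continuous])
  moreover have "{x \<in> topspace T. p x \<in> {p \<one>}} = H"
    using fibres[of \<one>] subgroup.subset[OF subgroup]
    by (auto simp: topspace eq_commute[of _ "p \<one>"])
  ultimately show ?thesis by simp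
qed

lemma coset_space:
  assumes "t1_space X"
  shows "coset_space X G T"
proof -
  let ?C = "coset_topology G T H" and ?\<pi> = "\<lambda>x. x <#\<^bsub>G\<^esub> H"
  have tC: "topspace ?C = lcosets H"
    using topspace_coset_topology[OF topspace] .
  have q: "quotient_map T ?C ?\<pi>"
    using quotient_map_coset_topology[OF topspace] .
  have qp: "quotient_map T X p"
    using continuous open_map surj by (simp add: continuous_open_imp_quotient_map topspace)
  have eq: "x <#\<^bsub>G\<^esub> H = y <#\<^bsub>G\<^esub> H \<longleftrightarrow> p x = p y" if "x \<in> carrier G" "y \<in> carrier G" for x y
    using that fibres subgroup
    by (metis l_repr_independence lcos_self subgroup.lcos_module_imp subgroup.lcos_module_rev is_group)
  define \<phi> where "\<phi> = (\<lambda>c. p (SOME x. x \<in> carrier G \<and> x <#\<^bsub>G\<^esub> H = c))"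
  have \<phi>: "\<phi> (x <#\<^bsub>G\<^esub> H) = p x" if "x \<in> carrier G" for x
  proof -
    have "(SOME y. y \<in> carrier G \<and> y <#\<^bsub>G\<^esub> H = x <#\<^bsub>G\<^esub> H) \<in> carrier G \<and>
        (SOME y. y \<in> carrier G \<and> y <#\<^bsub>G\<^esub> H = x <#\<^bsub>G\<^esub> H) <#\<^bsub>G\<^esub> H = x <#\<^bsub>G\<^esub> H"
      by (rule someI[of _ x]) (use that in simp)
    then show ?thesis unfolding \<phi>_def using eq that by blast
  qed
  have comp: "quotient_map T X (\<phi> \<circ> ?\<pi>)"
    by (rule quotient_map_eq[OF qp]) (simp add: topspace \<phi>)
  have "continuous_map ?C X \<phi>"
    using continuous_compose_quotient_map_eq[OF q] comp quotient_imp_continuous_map by blast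
  then have "quotient_map ?C X \<phi>"
    using quotient_map_from_composition[OF quotient_imp_continuous_map[OF q] _ comp] by blast
  moreover have "inj_on \<phi> (topspace ?C)"
    by (auto simp: tC LCOSETS_def inj_on_def \<phi> eq)
  ultimately have "homeomorphic_map ?C X \<phi>"
    by (simp add: homeomorphic_map_def)
  then have "X homeomorphic_space ?C"
    using homeomorphic_map_imp_homeomorphic_space homeomorphic_space_sym by blast
  then show ?thesis
    unfolding coset_space_def using topological_group subgroup closedin_subgroup[OF assms] by blast
qed

end

text \<open>The quotient map onto the cosets is open: the union of all cosets meeting an open set \<open>W\<close> is the
union of the right translates \<open>W h\<close> with \<open>h \<in> H\<close>.\<close>

lemma coset_space_parametrization:
  assumes "coset_space X G T"
  obtains H p where "coset_parametrization G T X H p"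
proof -
  from assms have T: "topological_group G T" by (simp add: coset_space_def)
  from assms obtain H where H: "subgroup H G" and hom: "X homeomorphic_space coset_topology G T H"
    by (auto simp: coset_space_def)
  interpret group G using T by (rule topological_groupD)
  have ts: "topspace T = carrier G" using T by (rule topological_groupD)
  let ?C = "coset_topology G T H" and ?\<pi> = "\<lambda>x. x <#\<^bsub>G\<^esub> H"
  have tC: "topspace ?C = lcosets\<^bsub>G\<^esub> H"
    using topspace_coset_topology[OF ts] .
  have q: "quotient_map T ?C ?\<pi>"
    using quotient_map_coset_topology[OF ts] .
  obtain \<phi> where \<phi>: "homeomorphic_map ?C X \<phi>"
    using hom homeomorphic_space homeomorphic_space_sym by blast
  have eq: "x <#\<^bsub>G\<^esub> H = y <#\<^bsub>G\<^esub> H \<longleftrightarrow> inv\<^bsub>G\<^esub> x \<otimes>\<^bsub>G\<^esub> y \<in> H" if "x \<in> carrier G" "y \<in> carrier G" for x y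
    using that H
    by (metis l_repr_independence lcos_self subgroup.lcos_module_imp subgroup.lcos_module_rev is_group)
  have op: "open_map T ?C ?\<pi>"
    unfolding open_map_def
  proof (intro allI impI)
    fix W assume W: "openin T W"
    have WG: "W \<subseteq> carrier G" using openin_subset[OF W] ts by simp
    have "{x \<in> carrier G. x <#\<^bsub>G\<^esub> H \<in> ?\<pi> ` W} = (\<Union>h\<in>H. (\<lambda>w. w \<otimes>\<^bsub>G\<^esub> h) ` W)"
    proof (intro equalityI subsetI)
      fix x assume "x \<in> {x \<in> carrier G. x <#\<^bsub>G\<^esub> H \<in> ?\<pi> ` W}"
      then obtain w where w: "x \<in> carrier G" "w \<in> W" "w <#\<^bsub>G\<^esub> H = x <#\<^bsub>G\<^esub> H" by auto
      then have "inv\<^bsub>G\<^esub> w \<otimes>\<^bsub>G\<^esub> x \<in> H" "x = w \<otimes>\<^bsub>G\<^esub> (inv\<^bsub>G\<^esub> w \<otimes>\<^bsub>G\<^esub> x)"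
        using WG by (auto simp: eq subset_iff m_assoc[symmetric])
      with w show "x \<in> (\<Union>h\<in>H. (\<lambda>w. w \<otimes>\<^bsub>G\<^esub> h) ` W)" by blast
    next
      fix x assume "x \<in> (\<Union>h\<in>H. (\<lambda>w. w \<otimes>\<^bsub>G\<^esub> h) ` W)"
      then obtain w h where wh: "w \<in> W" "h \<in> H" "x = w \<otimes>\<^bsub>G\<^esub> h" by blast
      moreover have "h \<in> carrier G" "w \<in> carrier G" using wh WG subgroup.subset[OF H] by auto
      ultimately have "x \<in> carrier G" "w <#\<^bsub>G\<^esub> H = x <#\<^bsub>G\<^esub> H"
        by (auto simp: eq m_assoc[symmetric])
      with wh show "x \<in> {x \<in> carrier G. x <#\<^bsub>G\<^esub> H \<in> ?\<pi> ` W}" by blast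
    qed
    moreover have "openin T (\<Union>h\<in>H. (\<lambda>w. w \<otimes>\<^bsub>G\<^esub> h) ` W)"
      using openin_right_translate[OF T W] subgroup.subset[OF H] by blast
    ultimately show "openin ?C (?\<pi> ` W)"
      using WG by (auto simp: openin_coset_topology LCOSETS_def)
  qed
  have "coset_parametrization G T X H (\<phi> \<circ> ?\<pi>)"
  proof (intro coset_parametrization.intro coset_parametrization_axioms.intro is_group)
    show "topological_group G T" "subgroup H G" by fact+
    show "continuous_map T X (\<phi> \<circ> ?\<pi>)"
      using q \<phi> by (meson continuous_map_compose homeomorphic_imp_continuous_map quotient_imp_continuous_map)
    show "open_map T X (\<phi> \<circ> ?\<pi>)"
      using op \<phi> by (meson open_map_compose homeomorphic_imp_open_map)
    show "(\<phi> \<circ> ?\<pi>) ` carrier G = topspace X"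
      using homeomorphic_imp_surjective_map[OF \<phi>] quotient_imp_surjective_map[OF q] ts
      by (metis image_comp)
    fix x y assume xy: "x \<in> carrier G" "y \<in> carrier G"
    then have "?\<pi> x \<in> topspace ?C" "?\<pi> y \<in> topspace ?C" by (auto simp: tC LCOSETS_def)
    then have "(\<phi> \<circ> ?\<pi>) x = (\<phi> \<circ> ?\<pi>) y \<longleftrightarrow> ?\<pi> x = ?\<pi> y"
      using homeomorphic_imp_injective_map[OF \<phi>] by (auto simp: inj_on_def)
    then show "(\<phi> \<circ> ?\<pi>) x = (\<phi> \<circ> ?\<pi>) y \<longleftrightarrow> inv\<^bsub>G\<^esub> x \<otimes>\<^bsub>G\<^esub> y \<in> H"
      using xy by (simp add: eq)
  qed
  then show thesis by (rule that)
qed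

section \<open>The group of uniform equivalences as acting group\<close>

lemma openin_mtopology_of_iff:
  "openin (mtopology_of m) U \<longleftrightarrow>
     U \<subseteq> mspace m \<and> (\<forall>x\<in>U. \<exists>r>0. \<forall>y\<in>mspace m. mdist m x y < r \<longrightarrow> y \<in> U)"
proof -
  interpret Metric_space "mspace m" "mdist m" by (rule Metric_space_mspace_mdist)
  have "mball x r \<subseteq> U \<longleftrightarrow> (\<forall>y\<in>mspace m. mdist m x y < r \<longrightarrow> y \<in> U)" if "x \<in> mspace m" for x r
    using that by auto
  then show ?thesis
    unfolding mtopology_of_def openin_mtopology by (metis subsetD)
qed

lemma uniform_equivalenceI:
  assumes "f \<in> extensional (mspace m)" "uniformly_continuous_map m m f" "uniformly_continuous_map m m g"
    and gf: "\<And>x. x \<in> mspace m \<Longrightarrow> g (f x) = x" and fg: "\<And>x. x \<in> mspace m \<Longrightarrow> f (g x) = x"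
  shows "f \<in> uniform_equivalences m"
proof -
  let ?M = "mspace m"
  have maps: "f \<in> ?M \<rightarrow> ?M" "g \<in> ?M \<rightarrow> ?M"
    using assms(2,3) by (auto dest: uniformly_continuous_map_funspace)
  then have bij: "bij_betw f ?M ?M"
    by (intro bij_betw_byWitness[where f' = g]) (auto simp: gf fg)
  have "inv_into ?M f x = g x" if "x \<in> ?M" for x
    using bij maps that fg by (intro inv_into_f_eq) (auto simp: bij_betw_def)
  then have "uniformly_continuous_map m m (inv_into ?M f)"
    using assms(3) by (subst uniformly_continuous_map_cong[of _ _ g]) auto
  then show ?thesis
    using assms(1,2) bij by (simp add: uniform_equivalences_def Bij_def)
qed

context coset_parametrization
begin

text \<open>The orbit map of the uniform equivalences at the base point of \<open>X\<close> is again a parametrization.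
It is onto because already \<open>G\<close> acts transitively. It is open because if \<open>O'\<close> is a neighborhood of \<open>f\<close> in the
group of uniform equivalences, then \<open>O'\<close> contains all composites of \<open>f\<close> with translations by
elements of some neighborhood \<open>W\<close> of the identity of \<open>G\<close>, and the values of these at the base point
form the image of an open translate of \<open>W\<close>.\<close>

theorem coset_space_uniform_equivalences:
  assumes m: "mtopology_of m = X"
    and ucont: "\<And>g. g \<in> carrier G \<Longrightarrow> uniformly_continuous_map m m (act g)"
    and small: "\<And>\<epsilon>. \<epsilon> > 0 \<Longrightarrow>
      \<exists>W. openin T W \<and> \<one> \<in> W \<and> (\<forall>w\<in>W. \<forall>u\<in>topspace X. mdist m (act w u) u < \<epsilon>)"
  shows "coset_space X (uniform_equivalence_group m) (uniform_convergence_topology m)"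
proof -
  let ?M = "mspace m" and ?U = "uniform_equivalences m"
  let ?K = "uniform_equivalence_group m" and ?TK = "uniform_convergence_topology m"
  interpret K: group ?K by (rule group_uniform_equivalence_group)
  note K_simps = uniform_equivalence_group_simps
  have M: "topspace X = ?M" using m by (metis topspace_mtopology_of)
  have t1: "t1_space X"
    using m Metric_space.t1_space_mtopology[OF Metric_space_mspace_mdist] by (metis mtopology_of_def)
  have maps: "f x \<in> ?M" if "f \<in> ?U" "x \<in> ?M" for f x
    using that by (auto simp: uniform_equivalences_def Bij_def bij_betw_def)
  have bij: "bij_betw f ?M ?M" if "f \<in> ?U" for f
    using that by (auto simp: uniform_equivalences_def Bij_def)
  define A where "A = (\<lambda>g. restrict (act g) ?M)"
  have A_unif: "A g \<in> ?U" if g: "g \<in> carrier G" for g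
  proof (rule uniform_equivalenceI)
    show "uniformly_continuous_map m m (A g)"
      using ucont[OF g] by (subst uniformly_continuous_map_cong[of _ _ "act g"]) (auto simp: A_def)
    show "uniformly_continuous_map m m (act (inv g))" using g by (intro ucont) simp
  qed (use g M act_closed[of "inv g"] in \<open>auto simp: A_def act_inv\<close>)
  define x0 where "x0 = p \<one>"
  have x0: "x0 \<in> ?M" using M by (simp add: x0_def flip: M)
  define S where "S = {f \<in> ?U. f x0 = x0}"
  have one_x0: "\<one>\<^bsub>?K\<^esub> x0 = x0" and one_U: "\<one>\<^bsub>?K\<^esub> \<in> ?U"
    using x0 K.one_closed by (auto simp: K_simps)
  have mult_x0: "(f \<otimes>\<^bsub>?K\<^esub> g) x0 = f (g x0)" "f \<otimes>\<^bsub>?K\<^esub> g \<in> ?U" if "f \<in> ?U" "g \<in> ?U" for f g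
    using that x0 K.m_closed[of f g] by (auto simp: K_simps compose_eq)
  have inv_U: "inv\<^bsub>?K\<^esub> f \<in> ?U" if "f \<in> ?U" for f
    using that K.inv_closed[of f] by (simp add: K_simps)
  have inv_f: "(inv\<^bsub>?K\<^esub> f) x = y \<longleftrightarrow> x = f y" if "f \<in> ?U" "x \<in> ?M" "y \<in> ?M" for f x y
    using that bij[OF that(1)] by (auto simp: inv_uniform_equivalence_group bij_betw_inv_into_left bij_betw_inv_into_right)
  have "coset_parametrization ?K ?TK X S (\<lambda>f. f x0)"
  proof (intro coset_parametrization.intro coset_parametrization_axioms.intro K.is_group)
    show "topological_group ?K ?TK" by (rule topological_group_uniform_equivalence_group)
    show "subgroup S ?K"
    proof (rule K.subgroupI)
      show "S \<subseteq> carrier ?K" by (auto simp: S_def K_simps)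
      show "S \<noteq> {}" using one_x0 one_U by (auto simp: S_def)
      show "inv\<^bsub>?K\<^esub> f \<in> S" if "f \<in> S" for f
        using that inv_U[of f] inv_f[of f x0 x0] x0 by (auto simp: S_def)
      show "f \<otimes>\<^bsub>?K\<^esub> g \<in> S" if "f \<in> S" "g \<in> S" for f g
        using that mult_x0[of f g] by (auto simp: S_def)
    qed
    show "continuous_map ?TK X (\<lambda>f. f x0)"
      unfolding continuous_map_def
    proof (intro conjI allI impI)
      show "(\<lambda>f. f x0) \<in> topspace ?TK \<rightarrow> topspace X" using maps x0 M by auto
      fix O' assume "openin X O'"
      then have O': "\<forall>x\<in>O'. \<exists>r>0. \<forall>y\<in>?M. mdist m x y < r \<longrightarrow> y \<in> O'"
        unfolding m[symmetric] openin_mtopology_of_iff by blast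
      show "openin ?TK {f \<in> topspace ?TK. f x0 \<in> O'}"
        unfolding openin_uniform_convergence_topology
      proof (intro conjI ballI)
        fix f assume "f \<in> {f \<in> topspace ?TK. f x0 \<in> O'}"
        then obtain r where "r > 0" "\<forall>y\<in>?M. mdist m (f x0) y < r \<longrightarrow> y \<in> O'"
          using O' by blast
        then show "\<exists>\<epsilon>>0. \<forall>g\<in>?U. (\<forall>x\<in>?M. mdist m (g x) (f x) < \<epsilon>) \<longrightarrow>
            g \<in> {f \<in> topspace ?TK. f x0 \<in> O'}"
          using x0 maps by (intro exI[of _ r]) (auto simp: mdist_commute)
      qed auto
    qed
    show "open_map ?TK X (\<lambda>f. f x0)"
      unfolding open_map_def
    proof (intro allI impI)
      fix O' assume O': "openin ?TK O'"
      show "openin X ((\<lambda>f. f x0) ` O')"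
      proof (subst openin_subopen, intro ballI)
        fix u assume "u \<in> (\<lambda>f. f x0) ` O'"
        then obtain f where f: "f \<in> O'" "u = f x0" by blast
        have fU: "f \<in> ?U" using openin_subset[OF O'] f by auto
        obtain \<epsilon> where e: "\<epsilon> > 0"
          "\<And>h. \<lbrakk>h \<in> ?U; \<forall>x\<in>?M. mdist m (h x) (f x) < \<epsilon>\<rbrakk> \<Longrightarrow> h \<in> O'"
          using O' f(1) unfolding openin_uniform_convergence_topology by meson
        obtain W where W: "openin T W" "\<one> \<in> W" "\<And>w v. \<lbrakk>w \<in> W; v \<in> ?M\<rbrakk> \<Longrightarrow> mdist m (act w v) v < \<epsilon>"
          using small[OF e(1)] unfolding M by metis
        have WG: "W \<subseteq> carrier G" using openin_subset[OF W(1)] by (simp add: topspace)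
        obtain g where g: "g \<in> carrier G" "u = p g"
          using maps[OF fU x0] f(2) M by (metis point_cases)
        let ?V = "p ` (\<lambda>w. w \<otimes> g) ` W"
        have "openin X ?V"
          using openin_right_translate[OF topological_group W(1) g(1)] open_map
          by (simp add: open_map_def)
        moreover have "u \<in> ?V"
        proof -
          have "u = p (\<one> \<otimes> g)" using g by simp
          then show ?thesis using W(2) by blast
        qed
        moreover have "?V \<subseteq> (\<lambda>f. f x0) ` O'"
        proof clarify
          fix w assume w: "w \<in> W"
          then have wG: "w \<in> carrier G" using WG by blast
          have "(A w \<otimes>\<^bsub>?K\<^esub> f) x = act w (f x)" if "x \<in> ?M" for x
            using A_unif[OF wG] fU maps[OF fU that] that by (simp add: K_simps compose_eq A_def)
          then have "A w \<otimes>\<^bsub>?K\<^esub> f \<in> O'"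
            using W(3)[OF w] maps[OF fU] A_unif[OF wG] fU mult_x0(2) by (intro e(2)) auto
          moreover have "(A w \<otimes>\<^bsub>?K\<^esub> f) x0 = p (w \<otimes> g)"
            using mult_x0(1)[OF A_unif[OF wG] fU] maps[OF fU x0] act_p[OF wG g(1)] f(2) g(2)
            by (simp add: A_def)
          ultimately show "p (w \<otimes> g) \<in> (\<lambda>f. f x0) ` O'"
            by (metis image_eqI)
        qed
        ultimately show "\<exists>V. openin X V \<and> u \<in> V \<and> V \<subseteq> (\<lambda>f. f x0) ` O'" by blast
      qed
    qed
    show "(\<lambda>f. f x0) ` carrier ?K = topspace X"
    proof
      show "(\<lambda>f. f x0) ` carrier ?K \<subseteq> topspace X" using maps x0 M by (auto simp: K_simps)
      show "topspace X \<subseteq> (\<lambda>f. f x0) ` carrier ?K"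
      proof
        fix u assume "u \<in> topspace X"
        then obtain g where g: "g \<in> carrier G" "u = p g" by (rule point_cases)
        then have "A g x0 = u" using x0 by (simp add: A_def act_p x0_def)
        then show "u \<in> (\<lambda>f. f x0) ` carrier ?K" using A_unif[OF g(1)] by (force simp: K_simps)
      qed
    qed
    show "f x0 = g x0 \<longleftrightarrow> inv\<^bsub>?K\<^esub> f \<otimes>\<^bsub>?K\<^esub> g \<in> S" if "f \<in> carrier ?K" "g \<in> carrier ?K" for f g
    proof -
      have fg: "f \<in> ?U" "g \<in> ?U" using that by (auto simp: K_simps)
      then have "(inv\<^bsub>?K\<^esub> f \<otimes>\<^bsub>?K\<^esub> g) x0 = x0 \<longleftrightarrow> g x0 = f x0"
        using mult_x0(1)[OF inv_U[OF fg(1)] fg(2)] inv_f maps x0 by simp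
      then show ?thesis using mult_x0(2)[OF inv_U[OF fg(1)] fg(2)] by (auto simp: S_def)
    qed
  qed
  then interpret K: coset_parametrization ?K ?TK X S "\<lambda>f. f x0" .
  show ?thesis by (rule K.coset_space[OF t1])
qed

end

section \<open>The norm of a metrizable group\<close>

text \<open>With \<open>s = t\<close> this halves a chain at one of its entries, which is the induction step of the chain
bound below.\<close>

lemma sum_list_split:
  fixes xs :: "real list"
  assumes "xs \<noteq> []" "sum_list xs < s + t" "0 < s" "0 < t"
  shows "\<exists>ys z zs. xs = ys @ z # zs \<and> sum_list ys < s \<and> sum_list zs < t"
  using assms
proof (induction xs arbitrary: s)
  case (Cons x xs)
  show ?case
  proof (cases "sum_list xs < t")
    case True
    then show ?thesis using Cons.prems by (intro exI[of _ "[]"]) auto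
  next
    case False
    then have "xs \<noteq> []" "sum_list xs < (s - x) + t" "0 < s - x" using Cons.prems by auto
    from Cons.IH[OF this \<open>0 < t\<close>] obtain ys z zs
      where "xs = ys @ z # zs" "sum_list ys < s - x" "sum_list zs < t" by blast
    then show ?thesis by (intro exI[of _ "x # ys"]) auto
  qed
qed simp

context group
begin

definition list_mult :: "'a list \<Rightarrow> 'a" where
  "list_mult xs = foldr (\<otimes>) xs \<one>"

lemma list_mult_simps [simp]: "list_mult [] = \<one>" "list_mult (x # xs) = x \<otimes> list_mult xs"
  by (auto simp: list_mult_def)

lemma list_mult_closed [simp]: "set xs \<subseteq> carrier G \<Longrightarrow> list_mult xs \<in> carrier G"
  by (induction xs) auto

lemma list_mult_append:
  "\<lbrakk>set xs \<subseteq> carrier G; set ys \<subseteq> carrier G\<rbrakk> \<Longrightarrow> list_mult (xs @ ys) = list_mult xs \<otimes> list_mult ys"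
  by (induction xs) (auto simp: m_assoc)

lemma list_mult_rev_inv:
  "set xs \<subseteq> carrier G \<Longrightarrow> list_mult (rev (map (m_inv G) xs)) = inv (list_mult xs)"
proof (induction xs)
  case (Cons x xs)
  then have "set (rev (map (m_inv G) xs)) \<subseteq> carrier G" by auto
  then show ?case using Cons by (simp add: list_mult_append inv_mult_group del: set_rev)
qed simp

text \<open>The heart of the Birkhoff-Kakutani theorem. Cut the chain at an entry \<open>z\<close> such that
the sums to the left and to the right of \<open>z\<close> are below \<open>s/2\<close>. By induction \<open>\<phi>\<close> is below \<open>s\<close> on both
partial products, it is below \<open>s\<close> at \<open>z\<close> as well, and the hypothesis on triple products loses a factor
2 only once.\<close>

lemma chain_bound:
  assumes nonneg: "\<And>x. x \<in> carrier G \<Longrightarrow> 0 \<le> \<phi> x" and one: "\<phi> \<one> = (0::real)"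
    and triple: "\<And>x y z s. \<lbrakk>x \<in> carrier G; y \<in> carrier G; z \<in> carrier G;
      \<phi> x < s; \<phi> y < s; \<phi> z < s\<rbrakk> \<Longrightarrow> \<phi> (x \<otimes> (y \<otimes> z)) < 2 * s"
    and "set xs \<subseteq> carrier G" "sum_list (map \<phi> xs) < s"
  shows "\<phi> (list_mult xs) < 2 * s"
  using assms(4,5)
proof (induction xs arbitrary: s rule: length_induct)
  case (1 xs)
  have "0 \<le> sum_list (map \<phi> xs)"
    using 1(2) nonneg by (intro sum_list_nonneg) auto
  then have s: "0 < s" using 1(3) by simp
  show ?case
  proof (cases "xs = []")
    case True
    then show ?thesis using s one by simp
  next
    case False
    have "\<exists>ys z zs. map \<phi> xs = ys @ z # zs \<and> sum_list ys < s/2 \<and> sum_list zs < s/2"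
      using False 1(3) s by (intro sum_list_split) auto
    then obtain ys z zs where xs: "xs = ys @ z # zs"
      and *: "sum_list (map \<phi> ys) < s/2" "sum_list (map \<phi> zs) < s/2"
      by (auto simp: map_eq_append_conv map_eq_Cons_conv)
    have sub: "set ys \<subseteq> carrier G" "set zs \<subseteq> carrier G" "z \<in> carrier G"
      using 1(2) xs by auto
    have "\<phi> (list_mult ys) < 2 * (s/2)" "\<phi> (list_mult zs) < 2 * (s/2)"
      using 1(1)[rule_format, of ys "s/2"] 1(1)[rule_format, of zs "s/2"] * sub xs by auto
    moreover have "\<phi> z < s"
    proof -
      have "0 \<le> sum_list (map \<phi> ys)" "0 \<le> sum_list (map \<phi> zs)"
        using sub by (auto intro!: sum_list_nonneg nonneg)
      then show ?thesis using 1(3) xs by simp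
    qed
    ultimately have "\<phi> (list_mult ys \<otimes> (z \<otimes> list_mult zs)) < 2 * s"
      using sub by (intro triple) auto
    then show ?thesis using sub by (simp add: xs list_mult_append)
  qed
qed

end

text \<open>Put \<open>\<phi> x = inf {1/2^n | x \<in> V n}\<close>; the condition \<open>V (n + 1)\<^sup>3 \<subseteq> V n\<close> is the triple product
hypothesis of the chain bound. The infimum \<open>N x\<close> of the sums of \<open>\<phi>\<close> over all factorizations of \<open>x\<close> is
subadditive by concatenation of factorizations, and \<open>\<phi> \<le> 2 N \<le> 2 \<phi>\<close> by the chain bound.\<close>

lemma (in group) norm_from_nbhd_sequence:
  assumes V0: "V 0 = carrier G"
    and one: "\<And>n. \<one> \<in> V n"
    and inv: "\<And>n x. x \<in> V n \<Longrightarrow> inv x \<in> V n"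
    and cube: "\<And>n x y z. \<lbrakk>x \<in> V (Suc n); y \<in> V (Suc n); z \<in> V (Suc n)\<rbrakk> \<Longrightarrow> x \<otimes> (y \<otimes> z) \<in> V n"
    and sub: "\<And>n. V n \<subseteq> carrier G"
  obtains N :: "'a \<Rightarrow> real" where
    "\<And>x. x \<in> carrier G \<Longrightarrow> 0 \<le> N x"
    "\<And>x y. \<lbrakk>x \<in> carrier G; y \<in> carrier G\<rbrakk> \<Longrightarrow> N (x \<otimes> y) \<le> N x + N y"
    "\<And>x. x \<in> carrier G \<Longrightarrow> N (inv x) = N x"
    "\<And>\<epsilon>. \<epsilon> > 0 \<Longrightarrow> \<exists>n. \<forall>x \<in> V n. N x < \<epsilon>"
    "\<And>n. \<exists>\<epsilon>>0. \<forall>x \<in> carrier G. N x < \<epsilon> \<longrightarrow> x \<in> V n"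
proof -
  have step: "V (Suc n) \<subseteq> V n" for n
  proof
    fix x assume x: "x \<in> V (Suc n)"
    then have "x \<otimes> (\<one> \<otimes> \<one>) \<in> V n" using one by (intro cube)
    then show "x \<in> V n" using x sub by (metis l_one one_closed r_one subsetD)
  qed
  have anti: "V n \<subseteq> V k" if "k \<le> n" for k n
    using lift_Suc_antimono_le[of V, OF step that] .
  define \<phi> where "\<phi> = (\<lambda>x. Inf {(1/2::real) ^ n | n. x \<in> V n})"
  have less: "\<phi> x < r \<longleftrightarrow> (\<exists>n. x \<in> V n \<and> (1/2) ^ n < r)" if "x \<in> carrier G" for x r
    unfolding \<phi>_def
    by (subst cInf_less_iff) (use that V0 in \<open>auto intro!: bdd_belowI[of _ 0]\<close>)
  have nonneg: "0 \<le> \<phi> x" if "x \<in> carrier G" for x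
    using less[OF that, of 0] by (smt (verit) zero_less_power half_gt_zero_iff)
  have phi_one: "\<phi> \<one> = 0"
  proof (rule ccontr)
    assume "\<phi> \<one> \<noteq> 0"
    then have "0 < \<phi> \<one>" using nonneg[of \<one>] by simp
    then obtain n where "(1/2::real) ^ n < \<phi> \<one>"
      using real_arch_pow_inv[of "\<phi> \<one>" "1/2"] by auto
    then show False using less[of \<one> "\<phi> \<one>"] one by auto
  qed
  have triple: "\<phi> (x \<otimes> (y \<otimes> z)) < 2 * s"
    if c: "x \<in> carrier G" "y \<in> carrier G" "z \<in> carrier G" and lt: "\<phi> x < s" "\<phi> y < s" "\<phi> z < s" for x y z s
  proof -
    obtain i j k where ijk: "x \<in> V i" "y \<in> V j" "z \<in> V k" "(1/2) ^ i < s" "(1/2) ^ j < s" "(1/2) ^ k < s"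
      using lt c less by metis
    obtain n where n: "x \<in> V n" "y \<in> V n" "z \<in> V n" "(1/2) ^ n < s"
    proof
      let ?n = "min i (min j k)"
      show "x \<in> V ?n" "y \<in> V ?n" "z \<in> V ?n"
        using ijk anti[of ?n i] anti[of ?n j] anti[of ?n k] by (auto simp: min.coboundedI2)
      show "(1/2) ^ ?n < s" using ijk by (auto simp: min_def)
    qed
    have "x \<otimes> (y \<otimes> z) \<in> V (n - 1) \<and> (1/2) ^ (n - 1) < 2 * s"
    proof (cases n)
      case 0
      then show ?thesis using n c V0 by auto
    next
      case (Suc k)
      then show ?thesis using n cube[of x k y z] by (auto simp: field_simps)
    qed
    then show ?thesis using less[of "x \<otimes> (y \<otimes> z)" "2 * s"] c by auto
  qed
  have phi_inv: "\<phi> (inv x) = \<phi> x" if "x \<in> carrier G" for x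
  proof -
    have "inv x \<in> V n \<longleftrightarrow> x \<in> V n" for n using inv[of x n] inv[of "inv x" n] that by auto
    then show ?thesis by (simp add: \<phi>_def)
  qed
  define R where "R = (\<lambda>x. {sum_list (map \<phi> xs) | xs. set xs \<subseteq> carrier G \<and> list_mult xs = x})"
  define N where "N = (\<lambda>x. Inf (R x))"
  have sum_nonneg: "0 \<le> sum_list (map \<phi> xs)" if "set xs \<subseteq> carrier G" for xs
    using that nonneg by (intro sum_list_nonneg) auto
  have bdd: "bdd_below (R x)" for x
    unfolding R_def using sum_nonneg by (auto intro!: bdd_belowI[of _ 0])
  have phi_R: "\<phi> x \<in> R x" if "x \<in> carrier G" for x
    unfolding R_def using that by (auto intro!: exI[of _ "[x]"])
  have N_less: "N x < r \<longleftrightarrow> (\<exists>xs. set xs \<subseteq> carrier G \<and> list_mult xs = x \<and> sum_list (map \<phi> xs) < r)"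
    if "x \<in> carrier G" for x r
  proof -
    have "R x \<noteq> {}" using phi_R[OF that] by blast
    then show ?thesis unfolding N_def by (subst cInf_less_iff[OF _ bdd]) (auto simp: R_def)
  qed
  have N_le_phi: "N x \<le> \<phi> x" if "x \<in> carrier G" for x
    unfolding N_def using phi_R[OF that] bdd by (rule cInf_lower)
  have phi_less: "\<phi> x < 2 * s" if "x \<in> carrier G" "N x < s" for x s
    using that N_less[of x s] chain_bound[of \<phi>, OF nonneg phi_one triple] by auto
  have N_add: "N (x \<otimes> y) \<le> N x + N y" if xy: "x \<in> carrier G" "y \<in> carrier G" for x y
  proof (rule field_le_epsilon)
    fix e :: real assume "0 < e"
    then obtain xs ys where
      "set xs \<subseteq> carrier G" "list_mult xs = x" "sum_list (map \<phi> xs) < N x + e/2"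
      "set ys \<subseteq> carrier G" "list_mult ys = y" "sum_list (map \<phi> ys) < N y + e/2"
      using N_less[of x "N x + e/2"] N_less[of y "N y + e/2"] xy by auto
    then have "N (x \<otimes> y) < (N x + e/2) + (N y + e/2)"
      using xy by (subst N_less) (auto intro!: exI[of _ "xs @ ys"] simp: list_mult_append)
    then show "N (x \<otimes> y) \<le> N x + N y + e" by simp
  qed
  have N_inv_le: "N (inv x) \<le> N x" if x: "x \<in> carrier G" for x
  proof (rule field_le_epsilon)
    fix e :: real assume "0 < e"
    then obtain xs where xs: "set xs \<subseteq> carrier G" "list_mult xs = x" "sum_list (map \<phi> xs) < N x + e"
      using N_less[of x "N x + e"] x by auto
    have "map (\<lambda>y. \<phi> (inv y)) xs = map \<phi> xs"
      using xs(1) phi_inv by (intro map_cong) auto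
    then have "sum_list (map \<phi> (rev (map (m_inv G) xs))) = sum_list (map \<phi> xs)"
      by (simp add: rev_map[symmetric] comp_def del: map_eq_conv)
    then have "N (inv x) < N x + e"
      using xs x subsetD[OF xs(1)] by (subst N_less)
        (auto intro!: exI[of _ "rev (map (m_inv G) xs)"] simp: list_mult_rev_inv)
    then show "N (inv x) \<le> N x + e" by simp
  qed
  show thesis
  proof (rule that[of N])
    show "0 \<le> N x" if "x \<in> carrier G" for x
      using N_less[OF that, of 0] sum_nonneg by (meson not_le)
    show "N (x \<otimes> y) \<le> N x + N y" if "x \<in> carrier G" "y \<in> carrier G" for x y
      using that by (rule N_add)
    show "N (inv x) = N x" if "x \<in> carrier G" for x
      using N_inv_le[of x] N_inv_le[of "inv x"] that by simp
    show "\<exists>n. \<forall>x \<in> V n. N x < \<epsilon>" if "\<epsilon> > 0" for \<epsilon>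
    proof -
      obtain n where n: "(1/2::real) ^ n < \<epsilon>"
        using real_arch_pow_inv[OF \<open>\<epsilon> > 0\<close>, of "1/2"] by auto
      have "N x < \<epsilon>" if "x \<in> V n" for x
      proof -
        have x: "x \<in> carrier G" using that sub by blast
        then have "\<phi> x < \<epsilon>" using that n less by blast
        then show ?thesis using N_le_phi[OF x] by simp
      qed
      then show ?thesis by blast
    qed
    show "\<exists>\<epsilon>>0. \<forall>x \<in> carrier G. N x < \<epsilon> \<longrightarrow> x \<in> V n" for n
    proof (intro exI[of _ "(1/2) ^ Suc n"] conjI ballI impI)
      fix x assume x: "x \<in> carrier G" "N x < (1/2) ^ Suc n"
      then have "\<phi> x < (1/2) ^ n" using phi_less[of x "(1/2) ^ Suc n"] by simp
      then obtain k where k: "x \<in> V k" "(1/2::real) ^ k < (1/2) ^ n" using less x by blast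
      then have "n \<le> k" using power_decreasing[of k n "1/2::real"] by fastforce
      then show "x \<in> V n" using anti k by blast
    qed simp
  qed
qed

lemma topological_group_sqrt_nbhd:
  assumes T: "topological_group G T" and V: "openin T V" "\<one>\<^bsub>G\<^esub> \<in> V"
  obtains W where "openin T W" "\<one>\<^bsub>G\<^esub> \<in> W" "\<And>x y. \<lbrakk>x \<in> W; y \<in> W\<rbrakk> \<Longrightarrow> x \<otimes>\<^bsub>G\<^esub> y \<in> V"
proof -
  interpret group G using T by (rule topological_groupD)
  have ts: "topspace T = carrier G" using T by (rule topological_groupD)
  have "openin (prod_topology T T) {z \<in> topspace (prod_topology T T). (case z of (x, y) \<Rightarrow> x \<otimes>\<^bsub>G\<^esub> y) \<in> V}"
    using topological_groupD(3)[OF T] V(1) by (rule openin_continuous_map_preimage)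
  then obtain A B where AB: "openin T A" "openin T B" "\<one>\<^bsub>G\<^esub> \<in> A" "\<one>\<^bsub>G\<^esub> \<in> B"
    and sub: "A \<times> B \<subseteq> {z \<in> topspace (prod_topology T T). (case z of (x, y) \<Rightarrow> x \<otimes>\<^bsub>G\<^esub> y) \<in> V}"
    unfolding openin_prod_topology_alt using V(2) ts
    by (drule_tac x = "\<one>\<^bsub>G\<^esub>" in spec, drule_tac x = "\<one>\<^bsub>G\<^esub>" in spec) auto
  show thesis
  proof (rule that[of "A \<inter> B"])
    show "openin T (A \<inter> B)" "\<one>\<^bsub>G\<^esub> \<in> A \<inter> B" using AB by (simp_all add: openin_Int)
    show "x \<otimes>\<^bsub>G\<^esub> y \<in> V" if "x \<in> A \<inter> B" "y \<in> A \<inter> B" for x y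
    proof -
      have "(x, y) \<in> A \<times> B" using that by blast
      from subsetD[OF sub this] show ?thesis by simp
    qed
  qed
qed

text \<open>If \<open>A A \<subseteq> V\<close> and \<open>B B \<subseteq> A\<close>, then every product of three elements of \<open>A \<inter> B\<close> lies in \<open>V\<close>, and
intersecting \<open>A \<inter> B\<close> with its inverse makes it symmetric.\<close>

lemma topological_group_cube_nbhd:
  assumes T: "topological_group G T" and V: "openin T V" "\<one>\<^bsub>G\<^esub> \<in> V"
  obtains W where "openin T W" "\<one>\<^bsub>G\<^esub> \<in> W" "\<And>x. x \<in> W \<Longrightarrow> inv\<^bsub>G\<^esub> x \<in> W"
    "\<And>x y z. \<lbrakk>x \<in> W; y \<in> W; z \<in> W\<rbrakk> \<Longrightarrow> x \<otimes>\<^bsub>G\<^esub> (y \<otimes>\<^bsub>G\<^esub> z) \<in> V"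
proof -
  interpret group G using T by (rule topological_groupD)
  have ts: "topspace T = carrier G" using T by (rule topological_groupD)
  obtain A where A: "openin T A" "\<one>\<^bsub>G\<^esub> \<in> A" "\<And>x y. \<lbrakk>x \<in> A; y \<in> A\<rbrakk> \<Longrightarrow> x \<otimes>\<^bsub>G\<^esub> y \<in> V"
    using topological_group_sqrt_nbhd[OF T V] by metis
  obtain B where B: "openin T B" "\<one>\<^bsub>G\<^esub> \<in> B" "\<And>x y. \<lbrakk>x \<in> B; y \<in> B\<rbrakk> \<Longrightarrow> x \<otimes>\<^bsub>G\<^esub> y \<in> A"
    using topological_group_sqrt_nbhd[OF T A(1,2)] by metis
  let ?C = "A \<inter> B"
  let ?W = "?C \<inter> {x \<in> topspace T. inv\<^bsub>G\<^esub> x \<in> ?C}"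
  have C: "openin T ?C" "\<one>\<^bsub>G\<^esub> \<in> ?C" "?C \<subseteq> carrier G"
    using A B openin_subset[OF A(1)] ts by auto
  have "openin T {x \<in> topspace T. inv\<^bsub>G\<^esub> x \<in> ?C}"
    using topological_groupD(4)[OF T] C(1) by (rule openin_continuous_map_preimage)
  then have W: "openin T ?W" using C(1) by blast
  have memC: "x \<in> carrier G \<and> x \<in> A \<and> x \<in> B" if "x \<in> ?C" for x using C(3) that by blast
  show thesis
  proof (rule that[OF W])
    show "\<one>\<^bsub>G\<^esub> \<in> ?W" using C(2) ts by simp
    show "inv\<^bsub>G\<^esub> x \<in> ?W" if "x \<in> ?W" for x
    proof -
      have x: "x \<in> A" "x \<in> B" "x \<in> carrier G" "inv\<^bsub>G\<^esub> x \<in> A" "inv\<^bsub>G\<^esub> x \<in> B"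
        using that memC[of x] by blast+
      then have "inv\<^bsub>G\<^esub> (inv\<^bsub>G\<^esub> x) = x" by (rule_tac inv_inv)
      then show ?thesis using x inv_closed[OF x(3)] unfolding ts by force
    qed
    show "x \<otimes>\<^bsub>G\<^esub> (y \<otimes>\<^bsub>G\<^esub> z) \<in> V" if "x \<in> ?W" "y \<in> ?W" "z \<in> ?W" for x y z
    proof -
      have "y \<otimes>\<^bsub>G\<^esub> z \<in> A" using that by (intro B(3)) blast+
      moreover have "x \<in> A" using that by blast
      ultimately show ?thesis using A(3) by blast
    qed
  qed
qed

text \<open>These are the distances to the identity for the right-invariant pseudometrics
\<open>d x y = N (x y\<^sup>-\<^sup>1)\<close> that induce the topology.\<close>

definition compatible_norm :: "('g, 'm) monoid_scheme \<Rightarrow> 'g topology \<Rightarrow> ('g \<Rightarrow> real) \<Rightarrow> bool" where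
  "compatible_norm G T N \<longleftrightarrow>
     (\<forall>x\<in>carrier G. 0 \<le> N x) \<and>
     (\<forall>x\<in>carrier G. \<forall>y\<in>carrier G. N (x \<otimes>\<^bsub>G\<^esub> y) \<le> N x + N y) \<and>
     (\<forall>x\<in>carrier G. N (inv\<^bsub>G\<^esub> x) = N x) \<and>
     (\<forall>\<epsilon>>0. \<exists>W. openin T W \<and> \<one>\<^bsub>G\<^esub> \<in> W \<and> (\<forall>x\<in>W. N x < \<epsilon>)) \<and>
     (\<forall>W. openin T W \<and> \<one>\<^bsub>G\<^esub> \<in> W \<longrightarrow> (\<exists>\<epsilon>>0. \<forall>x\<in>carrier G. N x < \<epsilon> \<longrightarrow> x \<in> W))"

lemma compatible_normD:
  assumes "compatible_norm G T N"
  shows "\<And>x. x \<in> carrier G \<Longrightarrow> 0 \<le> N x"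
    "\<And>x y. \<lbrakk>x \<in> carrier G; y \<in> carrier G\<rbrakk> \<Longrightarrow> N (x \<otimes>\<^bsub>G\<^esub> y) \<le> N x + N y"
    "\<And>x. x \<in> carrier G \<Longrightarrow> N (inv\<^bsub>G\<^esub> x) = N x"
    "\<And>\<epsilon>. \<epsilon> > 0 \<Longrightarrow> \<exists>W. openin T W \<and> \<one>\<^bsub>G\<^esub> \<in> W \<and> (\<forall>x\<in>W. N x < \<epsilon>)"
    "\<And>W. \<lbrakk>openin T W; \<one>\<^bsub>G\<^esub> \<in> W\<rbrakk> \<Longrightarrow> \<exists>\<epsilon>>0. \<forall>x \<in> carrier G. N x < \<epsilon> \<longrightarrow> x \<in> W"
  using assms by (simp_all add: compatible_norm_def)

text \<open>Shrinking the neighborhoods of the sequence into balls of radius \<open>1/(n + 1)\<close> for a metric of the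
group makes them a base at the identity.\<close>

theorem birkhoff_kakutani_norm:
  fixes G :: "('g, 'm) monoid_scheme"
  assumes T: "topological_group G T" and metr: "metrizable_space T"
  obtains N where "compatible_norm G T N"
proof -
  interpret group G using T by (rule topological_groupD)
  have ts: "topspace T = carrier G" using T by (rule topological_groupD)
  obtain M d where "Metric_space M d" and Md: "T = Metric_space.mtopology M d"
    using metr by (auto simp: metrizable_space_def)
  then interpret D: Metric_space M d by simp
  have M: "M = carrier G" using ts Md by simp
  let ?B = "\<lambda>n. D.mball \<one>\<^bsub>G\<^esub> (1 / Suc n)"
  define P where "P = (\<lambda>n V. openin T V \<and> \<one>\<^bsub>G\<^esub> \<in> V \<and> (\<forall>x\<in>V. inv\<^bsub>G\<^esub> x \<in> V) \<and> (n = (0::nat) \<longrightarrow> V = carrier G))"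
  define Q where "Q = (\<lambda>n V V'. (\<forall>x\<in>V'. \<forall>y\<in>V'. \<forall>z\<in>V'. x \<otimes>\<^bsub>G\<^esub> (y \<otimes>\<^bsub>G\<^esub> z) \<in> V) \<and> V' \<subseteq> ?B n)"
  have "openin T (carrier G)" using openin_topspace[of T] ts by simp
  then have "\<exists>V. P 0 V" by (auto simp: P_def)
  moreover have "\<exists>V'. P (Suc n) V' \<and> Q n V V'" if "P n V" for n V
  proof -
    have "openin T (?B n)" unfolding Md by (rule D.openin_mball)
    moreover have "\<one>\<^bsub>G\<^esub> \<in> ?B n" by (subst D.in_mball) (simp add: M)
    ultimately have O: "openin T (V \<inter> ?B n)" "\<one>\<^bsub>G\<^esub> \<in> V \<inter> ?B n"
      using \<open>P n V\<close> unfolding P_def by blast+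
    obtain W where W: "openin T W" "\<one>\<^bsub>G\<^esub> \<in> W" "\<And>x. x \<in> W \<Longrightarrow> inv\<^bsub>G\<^esub> x \<in> W"
      "\<And>x y z. \<lbrakk>x \<in> W; y \<in> W; z \<in> W\<rbrakk> \<Longrightarrow> x \<otimes>\<^bsub>G\<^esub> (y \<otimes>\<^bsub>G\<^esub> z) \<in> V \<inter> ?B n"
      using topological_group_cube_nbhd[OF T O] by metis
    have "W \<subseteq> ?B n"
    proof
      fix x assume x: "x \<in> W"
      have "x \<in> carrier G" using x openin_subset[OF W(1)] ts by blast
      then have "x \<otimes>\<^bsub>G\<^esub> (\<one>\<^bsub>G\<^esub> \<otimes>\<^bsub>G\<^esub> \<one>\<^bsub>G\<^esub>) = x" by simp
      then show "x \<in> ?B n" using W(4)[OF x W(2) W(2)] by simp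
    qed
    then show ?thesis using W unfolding P_def Q_def by (intro exI[of _ W]) blast
  qed
  ultimately obtain V where "\<forall>n. P n (V n) \<and> Q n (V n) (V (Suc n))"
    using dependent_nat_choice[of P Q] by blast
  then have V: "\<And>n. P n (V n)" "\<And>n. Q n (V n) (V (Suc n))" by auto
  have sub: "V n \<subseteq> carrier G" for n
    using V(1)[of n] openin_subset[of T "V n"] ts by (simp add: P_def)
  obtain N :: "'g \<Rightarrow> real" where N:
    "\<And>x. x \<in> carrier G \<Longrightarrow> 0 \<le> N x"
    "\<And>x y. \<lbrakk>x \<in> carrier G; y \<in> carrier G\<rbrakk> \<Longrightarrow> N (x \<otimes>\<^bsub>G\<^esub> y) \<le> N x + N y"
    "\<And>x. x \<in> carrier G \<Longrightarrow> N (inv\<^bsub>G\<^esub> x) = N x"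
    "\<And>\<epsilon>. \<epsilon> > 0 \<Longrightarrow> \<exists>n. \<forall>x \<in> V n. N x < \<epsilon>"
    "\<And>n. \<exists>\<epsilon>>0. \<forall>x \<in> carrier G. N x < \<epsilon> \<longrightarrow> x \<in> V n"
  proof (rule norm_from_nbhd_sequence[of V])
    show "V 0 = carrier G" using V(1)[of 0] by (simp add: P_def)
    show "\<one>\<^bsub>G\<^esub> \<in> V n" for n using V(1)[of n] by (simp add: P_def)
    show "inv\<^bsub>G\<^esub> x \<in> V n" if "x \<in> V n" for n x using V(1)[of n] that by (simp add: P_def)
    show "x \<otimes>\<^bsub>G\<^esub> (y \<otimes>\<^bsub>G\<^esub> z) \<in> V n" if "x \<in> V (Suc n)" "y \<in> V (Suc n)" "z \<in> V (Suc n)" for n x y z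
      using V(2)[of n] that by (simp add: Q_def)
  qed (use sub in blast)+
  show thesis
  proof (rule that[of N], unfold compatible_norm_def, intro conjI allI impI ballI)
    show "\<exists>W. openin T W \<and> \<one>\<^bsub>G\<^esub> \<in> W \<and> (\<forall>x\<in>W. N x < \<epsilon>)" if "\<epsilon> > 0" for \<epsilon>
      using N(4)[OF that] V(1) unfolding P_def by metis
    show "\<exists>\<epsilon>>0. \<forall>x \<in> carrier G. N x < \<epsilon> \<longrightarrow> x \<in> W" if W: "openin T W \<and> \<one>\<^bsub>G\<^esub> \<in> W" for W
    proof -
      obtain r where r: "r > 0" "D.mball \<one>\<^bsub>G\<^esub> r \<subseteq> W"
        using W unfolding Md D.openin_mtopology by blast
      obtain n where n: "1 / real (Suc n) < r"
        using nat_approx_posE[OF r(1)] by auto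
      have "V (Suc n) \<subseteq> ?B n" using V(2)[of n] by (simp add: Q_def)
      also have "?B n \<subseteq> D.mball \<one>\<^bsub>G\<^esub> r" using n by (intro D.mball_subset_concentric) simp
      finally show ?thesis using r(2) N(5)[of "Suc n"] by blast
    qed
  qed (use N in auto)
qed

section \<open>The quotient metric of a coset space\<close>

context coset_parametrization
begin

text \<open>The last two conditions make the action of \<open>G\<close> a continuous homomorphism into the group of uniform
equivalences of \<open>m\<close>.\<close>

definition admissible_metric :: "'b metric \<Rightarrow> bool" where
  "admissible_metric m \<longleftrightarrow>
     mtopology_of m = X \<and>
     (\<forall>g\<in>carrier G. uniformly_continuous_map m m (act g)) \<and>
     (\<forall>\<epsilon>>0. \<exists>W. openin T W \<and> \<one> \<in> W \<and> (\<forall>w\<in>W. \<forall>u\<in>topspace X. mdist m (act w u) u < \<epsilon>))"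

lemma act_transitive:
  assumes "u \<in> topspace X" "v \<in> topspace X"
  obtains z where "z \<in> carrier G" "act z u = v"
proof -
  obtain x y where x: "x \<in> carrier G" "u = p x" and y: "y \<in> carrier G" "v = p y"
    using assms point_cases by metis
  have "act (y \<otimes> inv x) u = v" using x y by (simp add: act_p m_assoc)
  then show thesis using that[of "y \<otimes> inv x"] x y by simp
qed

lemma openin_orbit_preimage:
  assumes U: "openin X U" and u: "u \<in> topspace X"
  shows "openin T {z \<in> carrier G. act z u \<in> U}"
proof -
  obtain x where x: "x \<in> carrier G" "u = p x" using u by (rule point_cases)
  have "continuous_map T T (\<lambda>z. z \<otimes> x)"
    using x by (intro continuous_map_group_mult[OF topological_group]) (auto simp: topspace)
  from continuous_map_compose[OF this continuous]
  have "openin T {z \<in> topspace T. (p \<circ> (\<lambda>z. z \<otimes> x)) z \<in> U}"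
    using U by (rule openin_continuous_map_preimage)
  moreover have "{z \<in> topspace T. (p \<circ> (\<lambda>z. z \<otimes> x)) z \<in> U} = {z \<in> carrier G. act z u \<in> U}"
    using x act_p by (auto simp: topspace)
  ultimately show ?thesis by simp
qed

lemma openin_orbit_image:
  assumes W: "openin T W" and u: "u \<in> topspace X"
  shows "openin X ((\<lambda>w. act w u) ` W)"
proof -
  obtain x where x: "x \<in> carrier G" "u = p x" using u by (rule point_cases)
  have "W \<subseteq> carrier G" using openin_subset[OF W] by (simp add: topspace)
  then have "(\<lambda>w. act w u) ` W = p ` (\<lambda>w. w \<otimes> x) ` W"
    unfolding image_image using x act_p by (intro image_cong) auto
  then show ?thesis
    using openin_right_translate[OF topological_group W x(1)] open_map by (simp add: open_map_def)
qed

lemma conjugation_nbhd: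
  assumes g: "g \<in> carrier G" and W: "openin T W" "\<one> \<in> W"
  shows "openin T {z \<in> carrier G. g \<otimes> (z \<otimes> inv g) \<in> W}" "\<one> \<in> {z \<in> carrier G. g \<otimes> (z \<otimes> inv g) \<in> W}"
proof -
  have "continuous_map T T (\<lambda>z. g \<otimes> (z \<otimes> inv g))"
    using g by (intro continuous_map_group_mult[OF topological_group]) (auto simp: topspace)
  then have "openin T {z \<in> topspace T. g \<otimes> (z \<otimes> inv g) \<in> W}"
    using W(1) by (rule openin_continuous_map_preimage)
  then show "openin T {z \<in> carrier G. g \<otimes> (z \<otimes> inv g) \<in> W}" by (simp add: topspace)
qed (use g W in simp)

text \<open>The distance from \<open>u\<close> to \<open>v\<close> is the least norm of a group element that carries \<open>u\<close> to \<open>v\<close>.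
Subadditivity and symmetry of the norm give the triangle inequality and symmetry. If \<open>z\<close> carries \<open>v\<close>
to \<open>u\<close>, then the conjugate of \<open>z\<close> by \<open>g\<close> carries \<open>g v\<close> to \<open>g u\<close>, so uniform continuity of translations
is continuity of conjugations at the identity.\<close>

theorem exists_admissible_metric:
  assumes T: "metrizable_space T" and t1: "t1_space X"
  obtains m where "admissible_metric m"
proof -
  obtain N where "compatible_norm G T N"
    using birkhoff_kakutani_norm[OF topological_group T] .
  note N_nonneg = compatible_normD(1)[OF this] and N_mult = compatible_normD(2)[OF this]
    and N_inv = compatible_normD(3)[OF this] and N_small = compatible_normD(4)[OF this]
    and N_nbhd = compatible_normD(5)[OF this]
  have N_one: "N \<one> = 0"
  proof (rule ccontr)
    assume "N \<one> \<noteq> 0"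
    then have "0 < N \<one>" using N_nonneg[of \<one>] by simp
    then show False using N_small by force
  qed
  let ?M = "topspace X"
  \<comment> \<open>\<open>G\<close> acts transitively, so the infimum is over a nonempty set\<close>
  define \<rho> where "\<rho> = (\<lambda>u v. Inf {N z | z. z \<in> carrier G \<and> act z u = v})"
  have bdd: "bdd_below {N z | z. z \<in> carrier G \<and> act z u = v}" for u v
    using N_nonneg by (auto intro!: bdd_belowI[of _ 0])
  have less: "\<rho> u v < r \<longleftrightarrow> (\<exists>z. z \<in> carrier G \<and> act z u = v \<and> N z < r)"
    if "u \<in> ?M" "v \<in> ?M" for u v r
  proof -
    have "{N z | z. z \<in> carrier G \<and> act z u = v} \<noteq> {}"
      using act_transitive[OF that] by blast
    then show ?thesis unfolding \<rho>_def by (subst cInf_less_iff[OF _ bdd]) auto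
  qed
  have le: "\<rho> u (act z u) \<le> N z" if "z \<in> carrier G" for z u
    unfolding \<rho>_def using that by (intro cInf_lower bdd) auto
  have nonneg: "0 \<le> \<rho> u v" if "u \<in> ?M" "v \<in> ?M" for u v
    using less[OF that, of 0] N_nonneg by (meson not_le)
  have sym: "\<rho> u v \<le> \<rho> v u" if uv: "u \<in> ?M" "v \<in> ?M" for u v
  proof (rule field_le_epsilon)
    fix e :: real assume "0 < e"
    then obtain z where z: "z \<in> carrier G" "act z v = u" "N z < \<rho> v u + e"
      using less[OF uv(2,1), of "\<rho> v u + e"] by auto
    then have "act (inv z) u = v" using act_inv uv by blast
    then show "\<rho> u v \<le> \<rho> v u + e" using le[of "inv z" u] z N_inv[OF z(1)] by simp
  qed
  have triangle: "\<rho> u w \<le> \<rho> u v + \<rho> v w" if uvw: "u \<in> ?M" "v \<in> ?M" "w \<in> ?M" for u v w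
  proof (rule field_le_epsilon)
    fix e :: real assume "0 < e"
    then obtain y z where y: "y \<in> carrier G" "act y u = v" "N y < \<rho> u v + e/2"
      and z: "z \<in> carrier G" "act z v = w" "N z < \<rho> v w + e/2"
      using less[of u v "\<rho> u v + e/2"] less[of v w "\<rho> v w + e/2"] uvw by auto
    have "act (z \<otimes> y) u = w" using y z uvw by (simp add: act_mult)
    then have "\<rho> u w \<le> N z + N y" using le[of "z \<otimes> y" u] N_mult[OF z(1) y(1)] y z by simp
    then show "\<rho> u w \<le> \<rho> u v + \<rho> v w + e" using y z by simp
  qed
  have ball_in_open: "\<exists>r>0. \<forall>v\<in>?M. \<rho> u v < r \<longrightarrow> v \<in> U" if U: "openin X U" "u \<in> U" for u U
  proof -
    have u: "u \<in> ?M" using U openin_subset by blast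
    have "\<one> \<in> {z \<in> carrier G. act z u \<in> U}" using U(2) act_one[OF u] by simp
    then obtain r where "r > 0" "\<forall>z\<in>carrier G. N z < r \<longrightarrow> act z u \<in> U"
      using N_nbhd[OF openin_orbit_preimage[OF U(1) u]] by blast
    then show ?thesis using less[OF u] by (intro exI[of _ r]) auto
  qed
  \<comment> \<open>A distance function must be nonnegative and symmetric off the space as well, whence the value 0 there.\<close>
  interpret R: Metric_space ?M "\<lambda>u v. if u \<in> ?M \<and> v \<in> ?M then \<rho> u v else 0"
  proof
    fix u v assume uv: "u \<in> ?M" "v \<in> ?M"
    have "\<rho> u u \<le> 0" using le[of \<one> u] N_one act_one[OF uv(1)] by simp
    moreover have "u = v" if "\<rho> u v = 0"
    proof (rule ccontr)
      assume "u \<noteq> v"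
      have "openin X (?M - {v})"
        using t1 uv(2) by (simp add: closedin_t1_singleton openin_diff)
      then obtain r where "r > 0" "\<forall>w\<in>?M. \<rho> u w < r \<longrightarrow> w \<in> ?M - {v}"
        using ball_in_open[of "?M - {v}" u] uv \<open>u \<noteq> v\<close> by blast
      then show False using that uv(2) by auto
    qed
    ultimately show "(if u \<in> ?M \<and> v \<in> ?M then \<rho> u v else 0) = 0 \<longleftrightarrow> u = v"
      using uv nonneg[OF uv(1,1)] by auto
  qed (use nonneg sym triangle in \<open>auto intro: order_antisym\<close>)
  define m where "m = metric (?M, \<lambda>u v. if u \<in> ?M \<and> v \<in> ?M then \<rho> u v else 0)"
  have mspace: "mspace m = ?M" unfolding m_def by (rule R.mspace_metric)
  have mdist: "mdist m u v = \<rho> u v" if "u \<in> ?M" "v \<in> ?M" for u v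
    using that by (simp add: m_def R.mdist_metric)
  have "openin (mtopology_of m) U \<longleftrightarrow> openin X U" for U
  proof
    assume U: "openin X U"
    show "openin (mtopology_of m) U"
      unfolding openin_mtopology_of_iff mspace
    proof (intro conjI ballI)
      show sub: "U \<subseteq> ?M" using U by (rule openin_subset)
      fix u assume u: "u \<in> U"
      obtain r where "r > 0" "\<forall>v\<in>?M. \<rho> u v < r \<longrightarrow> v \<in> U"
        using ball_in_open[OF U u] by blast
      then show "\<exists>r>0. \<forall>v\<in>?M. mdist m u v < r \<longrightarrow> v \<in> U"
        using mdist u sub by (intro exI[of _ r]) auto
    qed
  next
    assume U: "openin (mtopology_of m) U"
    then have sub: "U \<subseteq> ?M" unfolding openin_mtopology_of_iff mspace by blast
    show "openin X U"
    proof (subst openin_subopen, intro ballI)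
      fix u assume "u \<in> U"
      then have u: "u \<in> ?M" using sub by blast
      obtain r where r: "r > 0" "\<And>v. \<lbrakk>v \<in> ?M; \<rho> u v < r\<rbrakk> \<Longrightarrow> v \<in> U"
        using U \<open>u \<in> U\<close> mdist[OF u] unfolding openin_mtopology_of_iff mspace by metis
      obtain W where W: "openin T W" "\<one> \<in> W" "\<And>w. w \<in> W \<Longrightarrow> N w < r"
        using N_small[OF r(1)] by blast
      have WG: "W \<subseteq> carrier G" using openin_subset[OF W(1)] by (simp add: topspace)
      have "act w u \<in> U" if "w \<in> W" for w
      proof (rule r(2))
        have w: "w \<in> carrier G" using that WG by blast
        then show "act w u \<in> ?M" using u by (rule act_closed)
        show "\<rho> u (act w u) < r" using le[OF w, of u] W(3)[OF that] by simp
      qed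
      then show "\<exists>V. openin X V \<and> u \<in> V \<and> V \<subseteq> U"
        using openin_orbit_image[OF W(1) u] act_one[OF u] W(2)
        by (intro exI[of _ "(\<lambda>w. act w u) ` W"]) (metis image_subsetI image_eqI)
    qed
  qed
  then have "mtopology_of m = X" by (simp add: topology_eq)
  moreover have "uniformly_continuous_map m m (act g)" if g: "g \<in> carrier G" for g
    unfolding uniformly_continuous_map_def mspace
  proof (intro conjI allI impI)
    show "act g \<in> ?M \<rightarrow> ?M" using act_closed[OF g] by blast
    fix \<epsilon> :: real assume "\<epsilon> > 0"
    then obtain W where W: "openin T W" "\<one> \<in> W" "\<And>w. w \<in> W \<Longrightarrow> N w < \<epsilon>"
      using N_small by metis
    obtain \<delta> where d: "\<delta> > 0" "\<And>z. \<lbrakk>z \<in> carrier G; N z < \<delta>\<rbrakk> \<Longrightarrow> g \<otimes> (z \<otimes> inv g) \<in> W"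
      using N_nbhd[OF conjugation_nbhd[OF g W(1,2)]] by blast
    show "\<exists>\<delta>>0. \<forall>u\<in>?M. \<forall>v\<in>?M. mdist m v u < \<delta> \<longrightarrow> mdist m (act g v) (act g u) < \<epsilon>"
    proof (intro exI[of _ \<delta>] conjI ballI impI)
      fix u v assume uv: "u \<in> ?M" "v \<in> ?M" and "mdist m v u < \<delta>"
      then obtain z where z: "z \<in> carrier G" "act z v = u" "N z < \<delta>"
        using less[OF uv(2,1)] mdist by auto
      have "act (g \<otimes> (z \<otimes> inv g)) (act g v) = act g u"
        using g z uv by (simp add: act_mult act_closed act_inv)
      then have "\<rho> (act g v) (act g u) \<le> N (g \<otimes> (z \<otimes> inv g))"
        using le[of "g \<otimes> (z \<otimes> inv g)" "act g v"] g z by simp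
      also have "\<dots> < \<epsilon>" using d(2)[OF z(1,3)] by (rule W(3))
      finally show "mdist m (act g v) (act g u) < \<epsilon>"
        using mdist uv act_closed[OF g] by simp
    qed (rule d)
  qed
  moreover have "\<exists>W. openin T W \<and> \<one> \<in> W \<and> (\<forall>w\<in>W. \<forall>u\<in>?M. mdist m (act w u) u < \<epsilon>)"
    if \<epsilon>: "\<epsilon> > 0" for \<epsilon>
  proof -
    obtain W where W: "openin T W" "\<one> \<in> W" "\<And>w. w \<in> W \<Longrightarrow> N w < \<epsilon>"
      using N_small[OF \<epsilon>] by blast
    have WG: "W \<subseteq> carrier G" using openin_subset[OF W(1)] by (simp add: topspace)
    have "mdist m (act w u) u < \<epsilon>" if "w \<in> W" "u \<in> ?M" for w u
    proof -
      have w: "w \<in> carrier G" using that WG by blast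
      have "mdist m (act w u) u = \<rho> u (act w u)"
        using mdist[OF that(2) act_closed[OF w that(2)]] by (simp add: mdist_commute)
      then show ?thesis using le[OF w, of u] W(3)[OF that(1)] by simp
    qed
    then show ?thesis using W by blast
  qed
  ultimately have "admissible_metric m" by (simp add: admissible_metric_def)
  then show thesis by (rule that)
qed

end

section \<open>Totally bounded metrics and separability\<close>

text \<open>The functions \<open>F i\<close> are the coordinates of an injection into the Hilbert cube, and the weights
\<open>1/2^i\<close> make all but finitely many coordinates negligible.\<close>

lemma weighted_sup_metric:
  fixes F :: "nat \<Rightarrow> 'a \<Rightarrow> real"
  assumes F01: "\<And>i x. x \<in> M \<Longrightarrow> 0 \<le> F i x" "\<And>i x. x \<in> M \<Longrightarrow> F i x \<le> 1"
    and separating: "\<And>x y. \<lbrakk>x \<in> M; y \<in> M; \<And>i. F i x = F i y\<rbrakk> \<Longrightarrow> x = y"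
  obtains m where "mspace m = M"
    "\<forall>i. \<forall>x\<in>M. \<forall>y\<in>M. (1/2) ^ i * \<bar>F i x - F i y\<bar> \<le> mdist m x y"
    "\<forall>\<epsilon>>0. \<exists>k. \<forall>x\<in>M. \<forall>y\<in>M. (\<forall>i<k. \<bar>F i x - F i y\<bar> \<le> \<epsilon>) \<longrightarrow> mdist m x y \<le> \<epsilon>"
proof -
  define D where "D = (\<lambda>x y. if x \<in> M \<and> y \<in> M then SUP i. (1/2) ^ i * \<bar>F i x - F i y\<bar> else 0)"
  have term_le: "(1/2) ^ i * \<bar>F i x - F i y\<bar> \<le> (1/2) ^ i" if "x \<in> M" "y \<in> M" for i x y
  proof -
    have "\<bar>F i x - F i y\<bar> \<le> 1" using F01[of x i] F01[of y i] that by linarith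
    then show ?thesis using mult_left_mono[of "\<bar>F i x - F i y\<bar>" 1 "(1/2) ^ i"] by simp
  qed
  have bdd: "bdd_above (range (\<lambda>i. (1/2) ^ i * \<bar>F i x - F i y\<bar>))" if "x \<in> M" "y \<in> M" for x y
  proof (rule bdd_aboveI2)
    fix i
    have "(1/2::real) ^ i \<le> 1" by (simp add: power_le_one)
    then show "(1/2) ^ i * \<bar>F i x - F i y\<bar> \<le> 1" using term_le[OF that, of i] by linarith
  qed
  have le: "(1/2) ^ i * \<bar>F i x - F i y\<bar> \<le> D x y" if "x \<in> M" "y \<in> M" for i x y
    using cSUP_upper[OF UNIV_I bdd[OF that], of i] that by (simp add: D_def)
  have leI: "D x y \<le> c" if "x \<in> M" "y \<in> M" "\<And>i. (1/2) ^ i * \<bar>F i x - F i y\<bar> \<le> c" for x y c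
    using that by (auto simp: D_def intro!: cSUP_least)
  have nonneg: "0 \<le> D x y" for x y
  proof (cases "x \<in> M \<and> y \<in> M")
    case True
    then show ?thesis using le[of x y 0] by auto
  qed (auto simp: D_def)
  interpret Metric_space M D
  proof
    show "0 \<le> D x y" for x y by (rule nonneg)
    show "D x y = D y x" for x y by (simp add: D_def abs_minus_commute)
    fix x y assume xy: "x \<in> M" "y \<in> M"
    have "x = y" if "D x y = 0"
    proof (rule separating[OF xy])
      fix i
      have "(1/2) ^ i * \<bar>F i x - F i y\<bar> \<le> 0" using le[OF xy, of i] that by simp
      moreover have "0 < (1/2::real) ^ i" by simp
      ultimately show "F i x = F i y" by (simp add: mult_le_0_iff del: zero_less_power)
    qed
    moreover have "D x x = 0" using leI[OF xy(1,1), of 0] nonneg[of x x] by simp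
    ultimately show "D x y = 0 \<longleftrightarrow> x = y" by blast
  next
    fix x y z assume xyz: "x \<in> M" "y \<in> M" "z \<in> M"
    show "D x z \<le> D x y + D y z"
    proof (rule leI)
      fix i
      have "(1/2) ^ i * \<bar>F i x - F i z\<bar> \<le> (1/2) ^ i * (\<bar>F i x - F i y\<bar> + \<bar>F i y - F i z\<bar>)"
        by (intro mult_left_mono) auto
      also have "\<dots> \<le> D x y + D y z"
        using le[of x y i] le[of y z i] xyz by (simp add: distrib_left)
      finally show "(1/2) ^ i * \<bar>F i x - F i z\<bar> \<le> D x y + D y z" .
    qed (use xyz in auto)
  qed
  show thesis
  proof (rule that[of "metric (M, D)"]; (intro allI ballI impI)?)
    show "mspace (metric (M, D)) = M" by simp
    show "(1/2) ^ i * \<bar>F i x - F i y\<bar> \<le> mdist (metric (M, D)) x y" if "x \<in> M" "y \<in> M" for i x y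
      using le[OF that] by simp
    fix \<epsilon> :: real assume \<epsilon>: "\<epsilon> > 0"
    then obtain k where k: "(1/2::real) ^ k < \<epsilon>" using real_arch_pow_inv[of \<epsilon> "1/2"] by auto
    have "D x y \<le> \<epsilon>" if xy: "x \<in> M" "y \<in> M" and F: "\<forall>i<k. \<bar>F i x - F i y\<bar> \<le> \<epsilon>" for x y
    proof (rule leI[OF xy])
      fix i
      show "(1/2) ^ i * \<bar>F i x - F i y\<bar> \<le> \<epsilon>"
      proof (cases "i < k")
        case True
        then have "(1/2) ^ i * \<bar>F i x - F i y\<bar> \<le> 1 * \<epsilon>"
          using F \<epsilon> by (intro mult_mono power_le_one) auto
        then show ?thesis by simp
      next
        case False
        then have "(1/2::real) ^ i \<le> (1/2) ^ k" by (intro power_decreasing) auto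
        then show ?thesis using term_le[OF xy, of i] k by linarith
      qed
    qed
    then show "\<exists>k. \<forall>x\<in>M. \<forall>y\<in>M. (\<forall>i<k. \<bar>F i x - F i y\<bar> \<le> \<epsilon>) \<longrightarrow> mdist (metric (M, D)) x y \<le> \<epsilon>"
      by auto
  qed
qed

text \<open>Round finitely many coordinates down to multiples of \<open>1/(n + 1)\<close>. Only finitely many
rounded tuples occur, and points with the same tuple are close.\<close>

lemma totally_bounded_if_coordinates_control:
  fixes F :: "nat \<Rightarrow> 'a \<Rightarrow> real"
  assumes F01: "\<And>i x. x \<in> mspace m \<Longrightarrow> 0 \<le> F i x" "\<And>i x. x \<in> mspace m \<Longrightarrow> F i x \<le> 1"
    and control: "\<And>\<epsilon>. \<epsilon> > 0 \<Longrightarrow> \<exists>k. \<forall>x\<in>mspace m. \<forall>y\<in>mspace m.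
      (\<forall>i<k. \<bar>F i x - F i y\<bar> \<le> \<epsilon>) \<longrightarrow> mdist m x y \<le> \<epsilon>"
  shows "Metric_space.mtotally_bounded (mspace m) (mdist m) (mspace m)"
proof -
  let ?M = "mspace m"
  interpret Metric_space ?M "mdist m" by (rule Metric_space_mspace_mdist)
  show ?thesis
    unfolding mtotally_bounded_def
  proof (intro allI impI)
    fix \<epsilon> :: real assume \<epsilon>: "\<epsilon> > 0"
    then obtain k where k: "\<And>x y. \<lbrakk>x \<in> ?M; y \<in> ?M; \<forall>i<k. \<bar>F i x - F i y\<bar> \<le> \<epsilon>/2\<rbrakk> \<Longrightarrow> mdist m x y \<le> \<epsilon>/2"
      using control[of "\<epsilon>/2"] by (metis half_gt_zero)
    obtain n where n: "1 / real (Suc n) < \<epsilon>/2" using nat_approx_posE[of "\<epsilon>/2"] \<epsilon> by auto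
    define code where "code = (\<lambda>x. map (\<lambda>i. \<lfloor>F i x * real (Suc n)\<rfloor>) [0..<k])"
    have "code ` ?M \<subseteq> {xs. set xs \<subseteq> {0..int (Suc n)} \<and> length xs = k}"
    proof (rule image_subsetI)
      fix x assume x: "x \<in> ?M"
      have "\<lfloor>F i x * real (Suc n)\<rfloor> \<in> {0..int (Suc n)}" for i
      proof -
        have "0 \<le> F i x * real (Suc n)" using F01(1)[OF x] by (intro mult_nonneg_nonneg) auto
        moreover have "F i x * real (Suc n) \<le> real (Suc n)"
          using mult_right_mono[OF F01(2)[OF x, of i], of "real (Suc n)"] by simp
        ultimately show ?thesis
          by (metis atLeastAtMost_iff floor_mono floor_of_nat zero_le_floor)
      qed
      then show "code x \<in> {xs. set xs \<subseteq> {0..int (Suc n)} \<and> length xs = k}"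
        unfolding code_def by auto
    qed
    then have fin: "finite (code ` ?M)"
      by (rule finite_subset) (rule finite_lists_length_eq, simp)
    define r where "r = (\<lambda>c. SOME x. x \<in> ?M \<and> code x = c)"
    have r: "r (code x) \<in> ?M \<and> code (r (code x)) = code x" if "x \<in> ?M" for x
      unfolding r_def by (rule someI[of _ x]) (use that in simp)
    have "x \<in> mball (r (code x)) \<epsilon>" if x: "x \<in> ?M" for x
    proof -
      let ?y = "r (code x)"
      have "\<bar>F i ?y - F i x\<bar> \<le> \<epsilon>/2" if i: "i < k" for i
      proof -
        have "code ?y ! i = code x ! i" using r[OF x] by simp
        then have "\<lfloor>F i ?y * real (Suc n)\<rfloor> = \<lfloor>F i x * real (Suc n)\<rfloor>"
          using i by (simp add: code_def)
        then have "\<bar>F i ?y * real (Suc n) - F i x * real (Suc n)\<bar> \<le> 1" by linarith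
        then have "\<bar>F i ?y - F i x\<bar> * real (Suc n) \<le> 1"
          by (simp add: abs_mult left_diff_distrib[symmetric] del: of_nat_Suc)
        then have "\<bar>F i ?y - F i x\<bar> \<le> 1 / real (Suc n)" by (simp add: pos_le_divide_eq)
        then show ?thesis using n by linarith
      qed
      then have "mdist m ?y x \<le> \<epsilon>/2" using k r[OF x] x by blast
      then show ?thesis using r[OF x] x \<epsilon> by simp
    qed
    then have "?M \<subseteq> (\<Union>x\<in>r ` code ` ?M. mball x \<epsilon>)" by blast
    then show "\<exists>K. finite K \<and> K \<subseteq> ?M \<and> ?M \<subseteq> (\<Union>x\<in>K. mball x \<epsilon>)"
      using fin r by (intro exI[of _ "r ` code ` ?M"]) auto
  qed
qed

text \<open>For all \<open>k\<close> and \<open>n\<close> and every map \<open>\<phi>\<close> between the finite nets \<open>E k\<close> and \<open>E n\<close>, choose one equivalence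
that varies by less than \<open>1/(n + 1)\<close> at distances below \<open>1/(k + 1)\<close> and that is \<open>1/(n + 1)\<close>-close to \<open>\<phi>\<close>
on \<open>E k\<close>, if there is one. The countably many chosen equivalences are dense, since any
two equivalences with the same data are uniformly \<open>4/(n + 1)\<close>-close.\<close>

theorem separable_uniform_convergence_topology:
  assumes "Metric_space.mtotally_bounded (mspace m) (mdist m) (mspace m)"
  shows "separable_space (uniform_convergence_topology m)"
proof -
  let ?M = "mspace m" and ?U = "uniform_equivalences m" and ?T = "uniform_convergence_topology m"
  interpret Metric_space ?M "mdist m" by (rule Metric_space_mspace_mdist)
  have maps: "f x \<in> ?M" if "f \<in> ?U" "x \<in> ?M" for f x
    using that by (auto simp: uniform_equivalences_def Bij_def bij_betw_def)
  have "\<exists>K. finite K \<and> K \<subseteq> ?M \<and> (\<forall>x\<in>?M. \<exists>p\<in>K. mdist m p x < 1 / real (Suc n))" for n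
  proof -
    obtain K where K: "finite K" "K \<subseteq> ?M" "?M \<subseteq> (\<Union>x\<in>K. mball x (1 / real (Suc n)))"
      using assms[unfolded mtotally_bounded_def, rule_format, of "1 / real (Suc n)"] by auto
    have "\<exists>p\<in>K. mdist m p x < 1 / real (Suc n)" if "x \<in> ?M" for x
      using subsetD[OF K(3) that] by auto
    then show ?thesis using K by blast
  qed
  then obtain E where E: "\<And>n. finite (E n)" "\<And>n. E n \<subseteq> ?M"
    and net: "\<And>n x. x \<in> ?M \<Longrightarrow> \<exists>p\<in>E n. mdist m p x < 1 / real (Suc n)"
    by metis
  \<comment> \<open>\<open>near k n \<phi> f\<close>: the data \<open>k\<close>, \<open>n\<close>, \<open>\<phi>\<close> describe \<open>f\<close> up to \<open>1/(n + 1)\<close>\<close>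
  define near where "near = (\<lambda>k n \<phi> f. f \<in> ?U \<and>
    (\<forall>x\<in>?M. \<forall>y\<in>?M. mdist m y x < 1 / real (Suc k) \<longrightarrow> mdist m (f y) (f x) < 1 / real (Suc n)) \<and>
    (\<forall>p\<in>E k. mdist m (f p) (\<phi> p) < 1 / real (Suc n)))"
  define h where "h = (\<lambda>k n \<phi>. SOME f. near k n \<phi> f)"
  define C where "C = (\<Union>k n. h k n ` {\<phi> \<in> E k \<rightarrow>\<^sub>E E n. \<exists>f. near k n \<phi> f})"
  have h: "near k n \<phi> (h k n \<phi>)" if "near k n \<phi> f" for k n \<phi> f
    unfolding h_def by (rule someI[of _ f]) (rule that)
  have fin: "finite {\<phi> \<in> E k \<rightarrow>\<^sub>E E n. \<exists>f. near k n \<phi> f}" for k n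
  proof (rule finite_subset)
    show "finite (E k \<rightarrow>\<^sub>E E n)" using E(1) by (intro finite_PiE)
  qed blast
  have "countable C"
    unfolding C_def
    by (rule countable_UN[OF countableI_type], rule countable_UN[OF countableI_type],
        rule countable_image[OF countable_finite[OF fin]])
  moreover have CU: "C \<subseteq> ?U"
    unfolding C_def using h by (auto simp: near_def)
  moreover have "?T closure_of C = ?U"
  proof
    show "?T closure_of C \<subseteq> ?U" using closure_of_subset_topspace[of ?T C] by simp
    show "?U \<subseteq> ?T closure_of C"
    proof
      fix f assume f: "f \<in> ?U"
      have "\<exists>g\<in>C. g \<in> W" if W: "openin ?T W" "f \<in> W" for W
      proof -
        obtain \<epsilon> where e: "\<epsilon> > 0"
          "\<And>g. \<lbrakk>g \<in> ?U; \<forall>x\<in>?M. mdist m (g x) (f x) < \<epsilon>\<rbrakk> \<Longrightarrow> g \<in> W"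
          using W unfolding openin_uniform_convergence_topology by meson
        obtain n where n: "1 / real (Suc n) < \<epsilon>/4" using nat_approx_posE[of "\<epsilon>/4"] e by auto
        have "uniformly_continuous_map m m f" using f by (simp add: uniform_equivalences_def)
        then obtain \<delta> where d: "\<delta> > 0"
          "\<And>x y. \<lbrakk>x \<in> ?M; y \<in> ?M; mdist m y x < \<delta>\<rbrakk> \<Longrightarrow> mdist m (f y) (f x) < 1 / real (Suc n)"
          unfolding uniformly_continuous_map_def by (metis of_nat_0_less_iff zero_less_Suc zero_less_divide_1_iff)
        obtain k where k: "1 / real (Suc k) < \<delta>" using nat_approx_posE[OF d(1)] by auto
        have "\<forall>p. \<exists>q. p \<in> E k \<longrightarrow> q \<in> E n \<and> mdist m q (f p) < 1 / real (Suc n)"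
          using net maps[OF f] E(2) by blast
        then obtain \<psi> where psi: "\<And>p. p \<in> E k \<Longrightarrow> \<psi> p \<in> E n \<and> mdist m (\<psi> p) (f p) < 1 / real (Suc n)"
          by metis
        define \<phi> where "\<phi> = restrict \<psi> (E k)"
        have phi: "\<phi> \<in> E k \<rightarrow>\<^sub>E E n" "\<And>p. p \<in> E k \<Longrightarrow> mdist m (f p) (\<phi> p) < 1 / real (Suc n)"
          using psi by (auto simp: \<phi>_def mdist_commute)
        have "near k n \<phi> f"
          unfolding near_def using f phi(2) d(2) k by (auto intro: less_trans)
        define g where "g = h k n \<phi>"
        have g: "near k n \<phi> g" unfolding g_def using \<open>near k n \<phi> f\<close> by (rule h)
        have "g \<in> C" unfolding C_def g_def using \<open>near k n \<phi> f\<close> phi(1) by blast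
        have gU: "g \<in> ?U" using g by (simp add: near_def)
        have "mdist m (g x) (f x) < \<epsilon>" if x: "x \<in> ?M" for x
        proof -
          obtain q where q: "q \<in> E k" "mdist m q x < 1 / real (Suc k)" using net[OF x] by blast
          have qM: "q \<in> ?M" "\<phi> q \<in> ?M" using q(1) E(2) phi(1) by auto
          have "mdist m (g x) (g q) < 1 / real (Suc n)" "mdist m (f q) (f x) < 1 / real (Suc n)"
            using g \<open>near k n \<phi> f\<close> q(2) x qM(1) unfolding near_def by (simp_all add: mdist_commute)
          moreover have "mdist m (g q) (\<phi> q) < 1 / real (Suc n)" using g q(1) unfolding near_def by blast
          moreover have "mdist m (\<phi> q) (f q) < 1 / real (Suc n)" using phi(2)[OF q(1)] by (simp add: mdist_commute)
          moreover have "mdist m (g x) (f x) \<le> mdist m (g x) (g q) + mdist m (g q) (f x)"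
            using maps gU f x qM by (intro mdist_triangle) auto
          moreover have "mdist m (g q) (f x) \<le> mdist m (g q) (\<phi> q) + mdist m (\<phi> q) (f x)"
            using maps gU f x qM by (intro mdist_triangle) auto
          moreover have "mdist m (\<phi> q) (f x) \<le> mdist m (\<phi> q) (f q) + mdist m (f q) (f x)"
            using maps gU f x qM by (intro mdist_triangle) auto
          ultimately show ?thesis using n by linarith
        qed
        then have "g \<in> W" using e(2)[OF gU] by blast
        then show ?thesis using \<open>g \<in> C\<close> by blast
      qed
      then show "f \<in> ?T closure_of C" using f by (auto simp: in_closure_of)
    qed
  qed
  ultimately show ?thesis unfolding separable_space_def by (intro exI[of _ C]) simp
qed

section \<open>A totally bounded metric for separable groups\<close>

lemma finite_uniform_delta:
  fixes d :: "'c \<Rightarrow> real"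
  assumes "\<And>i. i < (k::nat) \<Longrightarrow> \<exists>\<delta>>0. \<forall>z\<in>S. d z < \<delta> \<longrightarrow> R i z"
  shows "\<exists>\<delta>>0. \<forall>z\<in>S. d z < \<delta> \<longrightarrow> (\<forall>i<k. R i z)"
  using assms
proof (induction k)
  case 0
  show ?case by (intro exI[of _ 1]) simp
next
  case (Suc k)
  then obtain \<delta> where d: "\<delta> > 0" "\<forall>z\<in>S. d z < \<delta> \<longrightarrow> (\<forall>i<k. R i z)" by auto
  obtain \<delta>' where d': "\<delta>' > 0" "\<forall>z\<in>S. d z < \<delta>' \<longrightarrow> R k z" using Suc.prems[of k] by auto
  show ?case
    using d d' by (intro exI[of _ "min \<delta> \<delta>'"]) (auto simp: less_Suc_eq)
qed

lemma finite_common_nbhd: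
  assumes "a \<in> topspace T"
    and "\<And>i. i < (k::nat) \<Longrightarrow> \<exists>W. openin T W \<and> a \<in> W \<and> (\<forall>w\<in>W. R i w)"
  shows "\<exists>W. openin T W \<and> a \<in> W \<and> (\<forall>w\<in>W. \<forall>i<k. R i w)"
  using assms(2)
proof (induction k)
  case 0
  show ?case using assms(1) by (intro exI[of _ "topspace T"]) simp
next
  case (Suc k)
  then obtain W where W: "openin T W" "a \<in> W" "\<forall>w\<in>W. \<forall>i<k. R i w" by auto
  obtain W' where W': "openin T W'" "a \<in> W'" "\<forall>w\<in>W'. R k w" using Suc.prems[of k] by auto
  show ?case
    using W W' by (intro exI[of _ "W \<inter> W'"]) (auto simp: less_Suc_eq openin_Int)
qed

lemma mtopology_of_eqI:
  assumes "mspace m = mspace m'"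
    and "\<And>u r. \<lbrakk>u \<in> mspace m; r > 0\<rbrakk> \<Longrightarrow> \<exists>s>0. \<forall>v\<in>mspace m. mdist m u v < s \<longrightarrow> mdist m' u v < r"
    and "\<And>u r. \<lbrakk>u \<in> mspace m; r > 0\<rbrakk> \<Longrightarrow> \<exists>s>0. \<forall>v\<in>mspace m. mdist m' u v < s \<longrightarrow> mdist m u v < r"
  shows "mtopology_of m = mtopology_of m'"
proof -
  have "openin (mtopology_of m) U \<longleftrightarrow> openin (mtopology_of m') U" for U
  proof -
    have *: "(\<exists>r>0. \<forall>y\<in>mspace m. mdist m u y < r \<longrightarrow> y \<in> U) \<longleftrightarrow>
        (\<exists>r>0. \<forall>y\<in>mspace m. mdist m' u y < r \<longrightarrow> y \<in> U)" if "u \<in> mspace m" for u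
      using assms(2,3)[OF that] by (meson)
    then show ?thesis
      unfolding openin_mtopology_of_iff assms(1)[symmetric]
      by (intro conj_cong ball_cong refl) (rule *, blast)
  qed
  then show ?thesis by (simp add: topology_eq)
qed

lemma separable_space_dense_set:
  assumes "separable_space X"
  obtains A where "countable A" "A \<subseteq> topspace X" "\<And>U u. \<lbrakk>openin X U; u \<in> U\<rbrakk> \<Longrightarrow> \<exists>a\<in>A. a \<in> U"
proof -
  obtain A where A: "countable A" "A \<subseteq> topspace X" "X closure_of A = topspace X"
    using assms by (auto simp: separable_space_def)
  have "\<exists>a\<in>A. a \<in> U" if U: "openin X U" "u \<in> U" for U u
  proof -
    have "u \<in> X closure_of A" using openin_subset[OF U(1)] U(2) A(3) by blast
    then show ?thesis using U by (auto simp: in_closure_of)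
  qed
  with A show thesis using that by blast
qed

context coset_parametrization
begin

text \<open>The coordinates are \<open>u \<mapsto> min 1 (d (q u) a)\<close> with \<open>q\<close> and \<open>a\<close> from countable dense sets. The identity
is included in the translating set, so that the coordinates with \<open>q = \<one>\<close> determine the topology.
Equivariance rests on \<open>Q_dense\<close>: every translation is a uniform limit of translations by elements of
\<open>Q\<close>, which follows from admissibility of the given metric alone. The new metric need not be uniformly
equivalent to the given one.\<close>

theorem exists_totally_bounded_admissible_metric:
  assumes adm: "admissible_metric m\<^sub>0" and sepX: "separable_space X" and sepT: "separable_space T"
  obtains m where "admissible_metric m" "Metric_space.mtotally_bounded (mspace m) (mdist m) (mspace m)"
proof -
  let ?M = "topspace X"
  define d where "d = mdist m\<^sub>0"
  have top0: "mtopology_of m\<^sub>0 = X" using adm by (simp add: admissible_metric_def)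
  have M: "mspace m\<^sub>0 = ?M" using top0 by (metis topspace_mtopology_of)
  have d_triangle: "d x z \<le> d x y + d y z" if "x \<in> ?M" "y \<in> ?M" "z \<in> ?M" for x y z
    using that mdist_triangle[of x m\<^sub>0 y z] by (simp add: d_def M)
  have d_commute: "d x y = d y x" for x y by (simp add: d_def mdist_commute)
  have d_nonneg: "0 \<le> d x y" for x y by (simp add: d_def)
  have d_zero: "d x y = 0 \<longleftrightarrow> x = y" if "x \<in> ?M" "y \<in> ?M" for x y
    using that by (simp add: d_def M)
  have act_ucont: "\<exists>\<delta>>0. \<forall>x\<in>?M. \<forall>y\<in>?M. d y x < \<delta> \<longrightarrow> d (act g y) (act g x) < \<epsilon>"
    if "g \<in> carrier G" "\<epsilon> > 0" for g \<epsilon>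
    using adm that unfolding admissible_metric_def uniformly_continuous_map_def d_def M by blast
  have small: "\<exists>W. openin T W \<and> \<one> \<in> W \<and> (\<forall>w\<in>W. \<forall>u\<in>?M. d (act w u) u < \<epsilon>)" if "\<epsilon> > 0" for \<epsilon>
    using adm that unfolding admissible_metric_def d_def by blast
  obtain A where A: "countable A" "A \<subseteq> ?M" "\<And>U u. \<lbrakk>openin X U; u \<in> U\<rbrakk> \<Longrightarrow> \<exists>a\<in>A. a \<in> U"
    using separable_space_dense_set[OF sepX] by metis
  obtain Q\<^sub>0 where Q0: "countable Q\<^sub>0" "Q\<^sub>0 \<subseteq> carrier G" "\<And>U u. \<lbrakk>openin T U; u \<in> U\<rbrakk> \<Longrightarrow> \<exists>q\<in>Q\<^sub>0. q \<in> U"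
    using separable_space_dense_set[OF sepT] unfolding topspace by metis
  define Q where "Q = insert \<one> Q\<^sub>0"
  have QG: "Q \<subseteq> carrier G" using Q0 by (simp add: Q_def)
  have A_dense: "\<exists>a\<in>A. d u a < r" if "u \<in> ?M" "r > 0" for u r
  proof -
    interpret D: Metric_space "mspace m\<^sub>0" "mdist m\<^sub>0" by (rule Metric_space_mspace_mdist)
    have "D.mball u r = {v \<in> ?M. d u v < r}"
      using that(1) unfolding d_def M[symmetric] by auto
    then have "openin X {v \<in> ?M. d u v < r}"
      using D.openin_mball[of u r] by (simp add: top0[symmetric] mtopology_of_def)
    moreover have "u \<in> {v \<in> ?M. d u v < r}" using that d_zero[of u u] by simp
    ultimately have "\<exists>a\<in>A. a \<in> {v \<in> ?M. d u v < r}" by (rule A(3))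
    then show ?thesis by auto
  qed
  have Q_dense: "\<exists>q\<in>Q. \<forall>u\<in>?M. d (act q u) (act g u) < \<epsilon>" if g: "g \<in> carrier G" and \<epsilon>: "\<epsilon> > 0" for g \<epsilon>
  proof -
    obtain W where W: "openin T W" "\<one> \<in> W" "\<And>w u. \<lbrakk>w \<in> W; u \<in> ?M\<rbrakk> \<Longrightarrow> d (act w u) u < \<epsilon>"
      using small[OF \<epsilon>] by blast
    have WG: "W \<subseteq> carrier G" using openin_subset[OF W(1)] by (simp add: topspace)
    have "g \<in> (\<lambda>w. w \<otimes> g) ` W" using W(2) g by (intro image_eqI[of _ _ \<one>]) auto
    then have "\<exists>q\<in>Q\<^sub>0. q \<in> (\<lambda>w. w \<otimes> g) ` W"
      by (rule Q0(3)[OF openin_right_translate[OF topological_group W(1) g]])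
    then obtain q where "q \<in> Q\<^sub>0" "q \<in> (\<lambda>w. w \<otimes> g) ` W" ..
    then obtain w where q: "q \<in> Q" "w \<in> W" "q = w \<otimes> g" by (auto simp: Q_def)
    have "d (act q u) (act g u) < \<epsilon>" if "u \<in> ?M" for u
      using W(3)[OF q(2) act_closed[OF g that]] act_mult[of w g u] q WG g that by auto
    then show ?thesis using q(1) by blast
  qed
  define I where "I = A \<times> Q"
  have I: "countable I" "I \<noteq> {}"
  proof -
    have "p \<one> \<in> ?M" by simp
    then have "A \<noteq> {}" using A_dense[of "p \<one>" 1] by auto
    then show "countable I" "I \<noteq> {}" using A(1) Q0(1) by (auto simp: I_def Q_def)
  qed
  define e where "e = from_nat_into I"
  define pt where "pt = (\<lambda>i. fst (e i))"
  define tr where "tr = (\<lambda>i. snd (e i))"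
  have e_I: "e i \<in> I" for i unfolding e_def using I(2) by (rule from_nat_into)
  have pt: "pt i \<in> ?M" and tr: "tr i \<in> carrier G" for i
    using e_I[of i] A(2) QG by (auto simp: I_def pt_def tr_def)
  have enum: "\<exists>i. pt i = a \<and> tr i = q" if "a \<in> A" "q \<in> Q" for a q
  proof -
    have "(a, q) \<in> I" using that by (simp add: I_def)
    then obtain n where "e n = (a, q)" using from_nat_into_surj[OF I(1)] unfolding e_def by blast
    then show ?thesis by (intro exI[of _ n]) (simp add: pt_def tr_def)
  qed
  have enum_tr: "\<exists>j. pt j = pt i \<and> tr j = q" if "q \<in> Q" for i q
    using e_I[of i] that by (intro enum) (auto simp: I_def pt_def)
  define F where "F = (\<lambda>i u. min 1 (d (act (tr i) u) (pt i)))"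
  have F01: "0 \<le> F i u" "F i u \<le> 1" for i u by (auto simp: F_def d_nonneg)
  have min_dist: "\<bar>min 1 (d x a) - min 1 (d y a)\<bar> \<le> d x y" if "x \<in> ?M" "y \<in> ?M" "a \<in> ?M" for x y a
    using d_triangle[of x y a] d_triangle[of y x a] d_commute[of x y] d_nonneg[of x y] that
    by (auto simp: min_def)
  have F_diff: "\<bar>F i u - F i v\<bar> \<le> d (act (tr i) u) (act (tr i) v)" if "u \<in> ?M" "v \<in> ?M" for i u v
    unfolding F_def using that pt tr by (intro min_dist) (auto simp: act_closed)
  have F_control: "\<exists>j s. s > 0 \<and> (\<forall>v\<in>?M. \<bar>F j u - F j v\<bar> < s \<longrightarrow> d u v < r)"
    if u: "u \<in> ?M" and r: "r > 0" for u r
  proof -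
    \<comment> \<open>The bound \<open>3 s \<le> 1\<close> keeps the truncation at 1 from hiding the distances to \<open>a\<close>.\<close>
    define s where "s = min 1 r / 3"
    have s: "s > 0" "3 * s \<le> 1" "3 * s \<le> r" using r by (auto simp: s_def)
    obtain a where a: "a \<in> A" "d u a < s" using A_dense[OF u s(1)] by blast
    obtain j where j: "pt j = a" "tr j = \<one>" using enum[OF a(1), of \<one>] by (auto simp: Q_def)
    have "d u v < r" if v: "v \<in> ?M" and "\<bar>F j u - F j v\<bar> < s" for v
    proof -
      have "F j u = min 1 (d u a)" "F j v = min 1 (d v a)"
        using u v by (simp_all add: F_def j act_one)
      then have "d v a < 2 * s" using that(2) a(2) s by (auto simp: min_def split: if_splits)
      then show ?thesis
        using d_triangle[of u a v] d_commute[of a v] a s A(2) u v by force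
    qed
    then show ?thesis using s(1) by blast
  qed
  have separating: "x = y" if "x \<in> ?M" "y \<in> ?M" "\<And>i. F i x = F i y" for x y
  proof (rule ccontr)
    assume "x \<noteq> y"
    then have "0 < d x y" using d_zero[of x y] d_nonneg[of x y] that by simp
    from F_control[OF that(1) this] obtain j s where s: "s > 0"
      and *: "\<forall>v\<in>?M. \<bar>F j x - F j v\<bar> < s \<longrightarrow> d x v < d x y"
      by blast
    show False using *[rule_format, OF that(2)] that(3)[of j] s by simp
  qed
  obtain m where mspace: "mspace m = ?M"
    and F_le: "\<forall>i. \<forall>x\<in>?M. \<forall>y\<in>?M. (1/2) ^ i * \<bar>F i x - F i y\<bar> \<le> mdist m x y"
    and control: "\<forall>\<epsilon>>0. \<exists>k. \<forall>x\<in>?M. \<forall>y\<in>?M. (\<forall>i<k. \<bar>F i x - F i y\<bar> \<le> \<epsilon>) \<longrightarrow> mdist m x y \<le> \<epsilon>"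
    by (rule weighted_sup_metric[of ?M F, OF F01 separating])
  have F_small: "\<bar>F i x - F i y\<bar> < s" if "x \<in> ?M" "y \<in> ?M" "mdist m x y < (1/2) ^ i * s" for i x y s
  proof -
    have "(1/2) ^ i * \<bar>F i x - F i y\<bar> < (1/2) ^ i * s"
      using F_le[rule_format, OF that(1,2), of i] that(3) by linarith
    then show ?thesis by (simp add: mult_less_cancel_left_pos)
  qed
  have control_less: "\<exists>k. \<forall>x\<in>?M. \<forall>y\<in>?M. (\<forall>i<k. \<bar>F i x - F i y\<bar> < \<epsilon>/2) \<longrightarrow> mdist m x y < \<epsilon>"
    if "\<epsilon> > 0" for \<epsilon>
  proof -
    have e2: "\<epsilon>/2 > 0" using that by simp
    from control[rule_format, OF e2] obtain k where
      k: "\<forall>x\<in>?M. \<forall>y\<in>?M. (\<forall>i<k. \<bar>F i x - F i y\<bar> \<le> \<epsilon>/2) \<longrightarrow> mdist m x y \<le> \<epsilon>/2" ..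
    have "mdist m x y < \<epsilon>" if "x \<in> ?M" "y \<in> ?M" "\<forall>i<k. \<bar>F i x - F i y\<bar> < \<epsilon>/2" for x y
    proof -
      have "mdist m x y \<le> \<epsilon>/2" using that by (intro k[rule_format]) (auto intro: less_imp_le)
      then show ?thesis using e2 by linarith
    qed
    then show ?thesis by (intro exI[of _ k] ballI impI)
  qed
  have "mtopology_of m = mtopology_of m\<^sub>0"
  proof (rule mtopology_of_eqI)
    show "mspace m = mspace m\<^sub>0" by (simp add: mspace M)
    fix u and r :: real assume "u \<in> mspace m" and r: "r > 0"
    then have u: "u \<in> ?M" by (simp add: mspace)
    obtain j s where js: "s > 0" "\<And>v. \<lbrakk>v \<in> ?M; \<bar>F j u - F j v\<bar> < s\<rbrakk> \<Longrightarrow> d u v < r"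
      using F_control[OF u r] by blast
    show "\<exists>s>0. \<forall>v\<in>mspace m. mdist m u v < s \<longrightarrow> mdist m\<^sub>0 u v < r"
      using js F_small[OF u] unfolding mspace d_def[symmetric]
      by (intro exI[of _ "(1/2) ^ j * s"]) auto
    from control_less[OF r] obtain k where
      k: "\<forall>x\<in>?M. \<forall>y\<in>?M. (\<forall>i<k. \<bar>F i x - F i y\<bar> < r/2) \<longrightarrow> mdist m x y < r" ..
    have "\<exists>\<delta>>0. \<forall>v\<in>?M. d u v < \<delta> \<longrightarrow> (\<forall>i<k. \<bar>F i u - F i v\<bar> < r/2)"
    proof (rule finite_uniform_delta)
      fix i
      have "r/2 > 0" using r by simp
      from act_ucont[OF tr this] obtain \<delta> where \<delta>: "\<delta> > 0"
        "\<forall>x\<in>?M. \<forall>y\<in>?M. d y x < \<delta> \<longrightarrow> d (act (tr i) y) (act (tr i) x) < r/2" by blast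
      have "\<bar>F i u - F i v\<bar> < r/2" if "v \<in> ?M" "d u v < \<delta>" for v
        using F_diff[OF u that(1), of i] \<delta>(2)[rule_format, OF that(1) u that(2)] by linarith
      then show "\<exists>\<delta>>0. \<forall>v\<in>?M. d u v < \<delta> \<longrightarrow> \<bar>F i u - F i v\<bar> < r/2"
        using \<delta>(1) by blast
    qed
    then show "\<exists>s>0. \<forall>v\<in>mspace m. mdist m\<^sub>0 u v < s \<longrightarrow> mdist m u v < r"
      unfolding mspace d_def[symmetric] using bspec[OF k u] by blast
  qed
  then have top: "mtopology_of m = X" by (simp add: top0)
  have ucont: "uniformly_continuous_map m m (act g)" if g: "g \<in> carrier G" for g
    unfolding uniformly_continuous_map_def mspace
  proof (intro conjI allI impI)
    show "act g \<in> ?M \<rightarrow> ?M" using act_closed[OF g] by blast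
    fix \<epsilon> :: real assume \<epsilon>: "\<epsilon> > 0"
    from control_less[OF \<epsilon>] obtain k where
      k: "\<forall>x\<in>?M. \<forall>y\<in>?M. (\<forall>i<k. \<bar>F i x - F i y\<bar> < \<epsilon>/2) \<longrightarrow> mdist m x y < \<epsilon>" ..
    have "\<exists>\<delta>>0. \<forall>z\<in>?M \<times> ?M. mdist m (fst z) (snd z) < \<delta> \<longrightarrow>
        (\<forall>i<k. \<bar>F i (act g (fst z)) - F i (act g (snd z))\<bar> < \<epsilon>/2)"
    proof (rule finite_uniform_delta)
      fix i
      have ig: "tr i \<otimes> g \<in> carrier G" using g tr by simp
      \<comment> \<open>The translated coordinate is approximated by the coordinate \<open>j\<close> with the same
        base point and the translation \<open>q\<close> near \<open>tr i \<otimes> g\<close>.\<close>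
      obtain q where q: "q \<in> Q" "\<And>u. u \<in> ?M \<Longrightarrow> d (act q u) (act (tr i \<otimes> g) u) < \<epsilon>/8"
        using Q_dense[OF ig, of "\<epsilon>/8"] \<epsilon> by (meson divide_pos_pos zero_less_numeral)
      obtain j where j: "pt j = pt i" "tr j = q" using enum_tr[OF q(1)] by blast
      have approx: "\<bar>F j u - F i (act g u)\<bar> < \<epsilon>/8" if u: "u \<in> ?M" for u
      proof -
        have "\<bar>F j u - F i (act g u)\<bar> \<le> d (act q u) (act (tr i \<otimes> g) u)"
          unfolding F_def j act_mult[OF tr g u, symmetric]
          using pt q(1) QG ig u by (intro min_dist) (auto intro: act_closed)
        then show ?thesis using q(2)[OF u] by simp
      qed
      show "\<exists>\<delta>>0. \<forall>z\<in>?M \<times> ?M. mdist m (fst z) (snd z) < \<delta> \<longrightarrow>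
          \<bar>F i (act g (fst z)) - F i (act g (snd z))\<bar> < \<epsilon>/2"
      proof (intro exI[of _ "(1/2) ^ j * (\<epsilon>/8)"] conjI ballI impI)
        fix z assume z: "z \<in> ?M \<times> ?M" "mdist m (fst z) (snd z) < (1/2) ^ j * (\<epsilon>/8)"
        then have "fst z \<in> ?M" "snd z \<in> ?M" by auto
        then show "\<bar>F i (act g (fst z)) - F i (act g (snd z))\<bar> < \<epsilon>/2"
          using approx[of "fst z"] approx[of "snd z"] F_small[OF _ _ z(2)] \<epsilon> by linarith
      qed (use \<epsilon> in simp)
    qed
    then obtain \<delta> where \<delta>: "\<delta> > 0" "\<forall>z\<in>?M \<times> ?M. mdist m (fst z) (snd z) < \<delta> \<longrightarrow>
        (\<forall>i<k. \<bar>F i (act g (fst z)) - F i (act g (snd z))\<bar> < \<epsilon>/2)"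
      by blast
    have "mdist m (act g y) (act g x) < \<epsilon>" if "x \<in> ?M" "y \<in> ?M" "mdist m y x < \<delta>" for x y
      using bspec[OF \<delta>(2), of "(y, x)"] k[rule_format, OF act_closed[OF g that(2)] act_closed[OF g that(1)]] that
      by simp
    then show "\<exists>\<delta>>0. \<forall>x\<in>?M. \<forall>y\<in>?M. mdist m y x < \<delta> \<longrightarrow> mdist m (act g y) (act g x) < \<epsilon>"
      using \<delta>(1) by (intro exI[of _ \<delta>] conjI ballI impI)
  qed
  have small_m: "\<exists>W. openin T W \<and> \<one> \<in> W \<and> (\<forall>w\<in>W. \<forall>u\<in>?M. mdist m (act w u) u < \<epsilon>)"
    if \<epsilon>: "\<epsilon> > 0" for \<epsilon>
  proof -
    from control_less[OF \<epsilon>] obtain k where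
      k: "\<forall>x\<in>?M. \<forall>y\<in>?M. (\<forall>i<k. \<bar>F i x - F i y\<bar> < \<epsilon>/2) \<longrightarrow> mdist m x y < \<epsilon>" ..
    have "\<exists>W. openin T W \<and> \<one> \<in> W \<and> (\<forall>w\<in>W. \<forall>i<k. \<forall>u\<in>?M. \<bar>F i (act w u) - F i u\<bar> < \<epsilon>/2)"
    proof (rule finite_common_nbhd)
      show "\<one> \<in> topspace T" by (simp add: topspace)
      fix i
      have "\<epsilon>/2 > 0" using \<epsilon> by simp
      from act_ucont[OF tr this] obtain \<delta> where \<delta>: "\<delta> > 0"
        "\<forall>x\<in>?M. \<forall>y\<in>?M. d y x < \<delta> \<longrightarrow> d (act (tr i) y) (act (tr i) x) < \<epsilon>/2" by blast
      obtain W where W: "openin T W" "\<one> \<in> W" "\<And>w u. \<lbrakk>w \<in> W; u \<in> ?M\<rbrakk> \<Longrightarrow> d (act w u) u < \<delta>"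
        using small[OF \<delta>(1)] by blast
      have WG: "W \<subseteq> carrier G" using openin_subset[OF W(1)] by (simp add: topspace)
      have "\<bar>F i (act w u) - F i u\<bar> < \<epsilon>/2" if "w \<in> W" "u \<in> ?M" for w u
      proof -
        have wu: "act w u \<in> ?M" using that WG act_closed by blast
        show ?thesis
          using F_diff[OF wu that(2), of i] \<delta>(2)[rule_format, OF that(2) wu W(3)[OF that]] by linarith
      qed
      then show "\<exists>W. openin T W \<and> \<one> \<in> W \<and> (\<forall>w\<in>W. \<forall>u\<in>?M. \<bar>F i (act w u) - F i u\<bar> < \<epsilon>/2)"
        using W(1,2) by blast
    qed
    then obtain W where W: "openin T W" "\<one> \<in> W"
      "\<And>w u. \<lbrakk>w \<in> W; u \<in> ?M\<rbrakk> \<Longrightarrow> \<forall>i<k. \<bar>F i (act w u) - F i u\<bar> < \<epsilon>/2" by blast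
    have "W \<subseteq> carrier G" using openin_subset[OF W(1)] by (simp add: topspace)
    then have "mdist m (act w u) u < \<epsilon>" if "w \<in> W" "u \<in> ?M" for w u
      using k[rule_format, OF act_closed that(2)] W(3)[OF that] that by blast
    then show ?thesis using W(1,2) by blast
  qed
  have "admissible_metric m"
    using top ucont small_m by (simp add: admissible_metric_def)
  moreover have "Metric_space.mtotally_bounded (mspace m) (mdist m) (mspace m)"
    by (rule totally_bounded_if_coordinates_control[of m F]) (use F01 control in \<open>auto simp: mspace\<close>)
  ultimately show thesis by (rule that)
qed

lemma admissible_metric_coset_space:
  assumes "admissible_metric m"
  shows "coset_space X (uniform_equivalence_group m) (uniform_convergence_topology m)"
  using assms by (intro coset_space_uniform_equivalences) (simp_all add: admissible_metric_def)

end

section \<open>The two characterizations\<close>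

lemma metrizable_imp_uniform_equivalences:
  assumes X: "metrizable_space X" and G: "coset_space_of_metrizable_group TYPE('g) X"
  shows "coset_space_of_uniform_equivalences X"
proof -
  obtain G :: "'g monoid" and T where T: "metrizable_space T" "coset_space X G T"
    using G by (auto simp: coset_space_of_metrizable_group_def)
  obtain H p where "coset_parametrization G T X H p"
    using coset_space_parametrization[OF T(2)] .
  then interpret coset_parametrization G T X H p .
  obtain m where m: "admissible_metric m"
    using exists_admissible_metric[OF T(1) metrizable_imp_t1_space[OF X]] .
  then show ?thesis
    unfolding coset_space_of_uniform_equivalences_def
    using admissible_metric_coset_space[OF m] by (auto simp: admissible_metric_def)
qed

lemma separable_metrizable_imp_totally_bounded_uniform_equivalences:
  assumes X: "separable_space X" "metrizable_space X"
    and G: "coset_space_of_separable_metrizable_group TYPE('g) X"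
  shows "coset_space_of_totally_bounded_uniform_equivalences X"
proof -
  obtain G :: "'g monoid" and T where T: "separable_space T" "metrizable_space T" "coset_space X G T"
    using G by (auto simp: coset_space_of_separable_metrizable_group_def)
  obtain H p where "coset_parametrization G T X H p"
    using coset_space_parametrization[OF T(3)] .
  then interpret coset_parametrization G T X H p .
  obtain m\<^sub>0 where "admissible_metric m\<^sub>0"
    using exists_admissible_metric[OF T(2) metrizable_imp_t1_space[OF X(2)]] .
  then obtain m where m: "admissible_metric m"
    "Metric_space.mtotally_bounded (mspace m) (mdist m) (mspace m)"
    using exists_totally_bounded_admissible_metric[OF _ X(1) T(1)] by blast
  then show ?thesis
    unfolding coset_space_of_totally_bounded_uniform_equivalences_def
    using admissible_metric_coset_space[OF m(1)] by (auto simp: admissible_metric_def)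
qed

(* A group with element type 'a => 'a witnesses (b) ==> (a); the additional implication
   extends (a) ==> (b) to groups whose elements have an arbitrary type 'g. *)
theorem theorem4p8:
  fixes X :: "'a topology"
  shows
    "(metrizable_space X \<longrightarrow>
        (coset_space_of_metrizable_group TYPE('a \<Rightarrow> 'a) X \<longleftrightarrow>
         coset_space_of_uniform_equivalences X) \<and>
        (coset_space_of_metrizable_group TYPE('g) X \<longrightarrow>
         coset_space_of_uniform_equivalences X)) \<and>
     (separable_space X \<and> metrizable_space X \<longrightarrow>
        (coset_space_of_separable_metrizable_group TYPE('a \<Rightarrow> 'a) X \<longleftrightarrow>
         coset_space_of_totally_bounded_uniform_equivalences X) \<and>
        (coset_space_of_separable_metrizable_group TYPE('g) X \<longrightarrow>
         coset_space_of_totally_bounded_uniform_equivalences X))"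
proof -
  have group: "coset_space_of_metrizable_group TYPE('a \<Rightarrow> 'a) X"
    if "coset_space_of_uniform_equivalences X"
    using that metrizable_uniform_convergence_topology
    unfolding coset_space_of_uniform_equivalences_def coset_space_of_metrizable_group_def by blast
  have separable_group: "coset_space_of_separable_metrizable_group TYPE('a \<Rightarrow> 'a) X"
    if "coset_space_of_totally_bounded_uniform_equivalences X"
    using that metrizable_uniform_convergence_topology separable_uniform_convergence_topology
    unfolding coset_space_of_totally_bounded_uniform_equivalences_def
      coset_space_of_separable_metrizable_group_def by blast
  show ?thesis
    by (intro conjI impI iffI; (elim conjE)?)
      (erule (1) metrizable_imp_uniform_equivalences | erule group | erule separable_group |
       erule (2) separable_metrizable_imp_totally_bounded_uniform_equivalences)+
qed

end
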